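(* Let $u=u(x,y,t)$ be a solution of the dKP equation $(u_t-uu_x)_x=u_{yy}$, put $$h=\mathrm{d}y^2-4\,\mathrm{d}x\,\mathrm{d}t-4u\,\mathrm{d}t^2,\qquad \nu=-4u_x\,\mathrm{d}t,$$ and let $V=V(x,y,t)$ be a nowhere vanishing solution of the linearised dKP equation $$V_{yy}-V_{xt}+uV_{xx}+2u_xV_x+u_{xx}V=0.$$ Then locally there exists a one-form $\alpha$ on the space with coordinates $(x,y,t)$ satisfying $$\ast_h\big(\mathrm{d}V+\tfrac12\nu V\big)=\mathrm{d}\alpha,$$ and the four-dimensional metric $$g=Vh-V^{-1}(\mathrm{d}z+\alpha)^2$$ is anti-self-dual and has $\partial_z$ as a Killing vector.
   Context: All objects are smooth real or holomorphic, defined locally. The Hodge operator $\ast_h$ of $h$ is given on one-forms by $$\ast_h\mathrm{d}t=\mathrm{d}t\wedge\mathrm{d}y,\qquad \ast_h\mathrm{d}y=2\,\mathrm{d}t\wedge\mathrm{d}x,\qquad \ast_h\mathrm{d}x=\mathrm{d}y\wedge\mathrm{d}x+2u\,\mathrm{d}y\wedge\mathrm{d}t.$$ A four-dimensional metric (real of signature $(++--)$, or holomorphic) is anti-self-dual if, for the appropriate choice of orientation, the self-dual part of its Weyl tensor vanishes; this depends only on the conformal class. Products of one-forms in a metric are symmetric products. *)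

theory Defs
  imports "HOL-Analysis.Analysis"
begin

text \<open>
  Everything is written in coordinates over a scalar type of class
  \<open>real_normed_field\<close>. Instantiated with \<open>real\<close>, smoothness below is real smoothness;
  instantiated with \<open>complex\<close>, partial derivatives are complex derivatives and
  smoothness is holomorphy (Osgood). A field in both \<open>real_normed_field\<close> and
  \<open>euclidean_space\<close> is a copy of one of these two, so that pair of classes covers
  exactly the smooth real and the holomorphic category.
\<close>

section \<open>Smooth functions of several variables\<close>

definition partial_deriv ::
  "'n::finite \<Rightarrow> ('k::real_normed_field ^ 'n \<Rightarrow> 'k) \<Rightarrow> 'k ^ 'n \<Rightarrow> 'k" where
  "partial_deriv i f p = deriv (\<lambda>s. f (p + s *s axis i 1)) 0"

primrec Ck_on ::
  "nat \<Rightarrow> ('k::real_normed_field ^ 'n::finite) set \<Rightarrow> ('k ^ 'n \<Rightarrow> 'k) \<Rightarrow> bool" where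
  "Ck_on 0 S f \<longleftrightarrow> continuous_on S f"
| "Ck_on (Suc k) S f \<longleftrightarrow> continuous_on S f \<and>
     (\<forall>i. (\<forall>p\<in>S. (\<lambda>s. f (p + s *s axis i 1)) field_differentiable (at 0)) \<and>
          Ck_on k S (partial_deriv i f))"

text \<open>Meaningful for open sets only.\<close>

definition smooth_on ::
  "('k::real_normed_field ^ 'n::finite) set \<Rightarrow> ('k ^ 'n \<Rightarrow> 'k) \<Rightarrow> bool" where
  "smooth_on S f \<longleftrightarrow> (\<forall>k. Ck_on k S f)"

section \<open>Forms and symmetric products\<close>

text \<open>
  A one-form at a point is its vector of components; a two-tensor at a point is its matrix
  of components, and a two-form is an antisymmetric such matrix, with
  \<open>a \<and> b = a \<otimes> b - b \<otimes> a\<close>. Symmetric products are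
  \<open>a b = (a \<otimes> b + b \<otimes> a) / 2\<close>.
\<close>

definition tensor_scale ::
  "'k::field \<Rightarrow> 'k ^ 'n ^ 'm \<Rightarrow> 'k ^ 'n ^ 'm" (infixr \<open>*\<^sub>t\<close> 70) where
  "c *\<^sub>t A = (\<chi> i j. c * A $ i $ j)"

definition sym_prod :: "'k::field ^ 'n \<Rightarrow> 'k ^ 'n \<Rightarrow> 'k ^ 'n ^ 'n" where
  "sym_prod a b = (\<chi> i j. (a $ i * b $ j + b $ i * a $ j) / 2)"

definition wedge :: "'k::field ^ 'n \<Rightarrow> 'k ^ 'n \<Rightarrow> 'k ^ 'n ^ 'n" where
  "wedge a b = (\<chi> i j. a $ i * b $ j - b $ i * a $ j)"

definition ext_deriv0 ::
  "('k::real_normed_field ^ 'n::finite \<Rightarrow> 'k) \<Rightarrow> 'k ^ 'n \<Rightarrow> 'k ^ 'n" where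
  "ext_deriv0 f p = (\<chi> i. partial_deriv i f p)"

definition ext_deriv1 ::
  "('k::real_normed_field ^ 'n::finite \<Rightarrow> 'k ^ 'n) \<Rightarrow> 'k ^ 'n \<Rightarrow> 'k ^ 'n ^ 'n" where
  "ext_deriv1 \<alpha> p =
     (\<chi> i j. partial_deriv i (\<lambda>q. \<alpha> q $ j) p - partial_deriv j (\<lambda>q. \<alpha> q $ i) p)"

definition smooth_one_form_on ::
  "('k::real_normed_field ^ 'n::finite) set \<Rightarrow> ('k ^ 'n \<Rightarrow> 'k ^ 'n) \<Rightarrow> bool" where
  "smooth_one_form_on S \<alpha> \<longleftrightarrow> (\<forall>i. smooth_on S (\<lambda>p. \<alpha> p $ i))"

section \<open>Four-dimensional metrics and anti-self-duality\<close>

type_synonym 'k metric4 = "'k ^ 4 \<Rightarrow> 'k ^ 4 ^ 4"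

text \<open>
  Over the reals the last clause of \<open>metric4_on\<close> says that the signature is
  \<open>(++--)\<close>; over the complex numbers it is nondegeneracy, by Sylvester's theorem.
\<close>

definition split_form :: "'k::field ^ 4 ^ 4" where
  "split_form = (\<chi> i j. if i = j then (if i = 1 \<or> i = 2 then 1 else -1) else 0)"

definition metric4_on :: "('k::real_normed_field ^ 4) set \<Rightarrow> 'k metric4 \<Rightarrow> bool" where
  "metric4_on S g \<longleftrightarrow>
     (\<forall>i j. smooth_on S (\<lambda>p. g p $ i $ j)) \<and>
     (\<forall>p\<in>S. transpose (g p) = g p) \<and>
     (\<forall>p\<in>S. \<exists>B. transpose B ** g p ** B = split_form)"

definition christoffel ::
  "'k::real_normed_field metric4 \<Rightarrow> 4 \<Rightarrow> 4 \<Rightarrow> 4 \<Rightarrow> 'k ^ 4 \<Rightarrow> 'k" where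
  "christoffel g k i j p =
     (\<Sum>l\<in>UNIV. matrix_inv (g p) $ k $ l *
        (partial_deriv i (\<lambda>q. g q $ j $ l) p + partial_deriv j (\<lambda>q. g q $ i $ l) p
         - partial_deriv l (\<lambda>q. g q $ i $ j) p)) / 2"

text \<open>
  The component \<open>R\<^sup>l\<^sub>k\<^sub>i\<^sub>j\<close>, where
  \<open>R(\<partial>\<^sub>i, \<partial>\<^sub>j) \<partial>\<^sub>k = R\<^sup>l\<^sub>k\<^sub>i\<^sub>j \<partial>\<^sub>l\<close>.
\<close>

definition riemann_up ::
  "'k::real_normed_field metric4 \<Rightarrow> 4 \<Rightarrow> 4 \<Rightarrow> 4 \<Rightarrow> 4 \<Rightarrow> 'k ^ 4 \<Rightarrow> 'k" where
  "riemann_up g l k i j p =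
     partial_deriv i (christoffel g l j k) p - partial_deriv j (christoffel g l i k) p
     + (\<Sum>m\<in>UNIV. christoffel g l i m p * christoffel g m j k p
                 - christoffel g l j m p * christoffel g m i k p)"

definition riemann ::
  "'k::real_normed_field metric4 \<Rightarrow> 4 \<Rightarrow> 4 \<Rightarrow> 4 \<Rightarrow> 4 \<Rightarrow> 'k ^ 4 \<Rightarrow> 'k" where
  "riemann g l k i j p = (\<Sum>m\<in>UNIV. g p $ l $ m * riemann_up g m k i j p)"

definition ricci :: "'k::real_normed_field metric4 \<Rightarrow> 4 \<Rightarrow> 4 \<Rightarrow> 'k ^ 4 \<Rightarrow> 'k" where
  "ricci g k j p = (\<Sum>i\<in>UNIV. riemann_up g i k i j p)"

definition scalar_curvature :: "'k::real_normed_field metric4 \<Rightarrow> 'k ^ 4 \<Rightarrow> 'k" where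
  "scalar_curvature g p =
     (\<Sum>k\<in>UNIV. \<Sum>j\<in>UNIV. matrix_inv (g p) $ k $ j * ricci g k j p)"

definition weyl ::
  "'k::real_normed_field metric4 \<Rightarrow> 4 \<Rightarrow> 4 \<Rightarrow> 4 \<Rightarrow> 4 \<Rightarrow> 'k ^ 4 \<Rightarrow> 'k" where
  "weyl g l k i j p =
     riemann g l k i j p
     - (g p $ l $ i * ricci g k j p - g p $ l $ j * ricci g k i p
        - g p $ k $ i * ricci g l j p + g p $ k $ j * ricci g l i p) / 2
     + scalar_curvature g p / 6
       * (g p $ l $ i * g p $ k $ j - g p $ l $ j * g p $ k $ i)"

definition levi_civita :: "4 \<Rightarrow> 4 \<Rightarrow> 4 \<Rightarrow> 4 \<Rightarrow> 'k::field" where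
  "levi_civita i j k l = det (vector [axis i 1, axis j 1, axis k 1, axis l 1] :: 'k ^ 4 ^ 4)"

text \<open>
  An orientation is given by a metric volume form
  \<open>\<omega> dx\<^sup>1 \<and> dx\<^sup>2 \<and> dx\<^sup>3 \<and> dx\<^sup>4\<close>,
  where \<open>\<omega>\<close> is one of the two square roots of \<open>det g\<close> (which is positive for real
  metrics of signature \<open>(++--)\<close>). The induced Hodge operator on two-forms squares to
  the identity.
\<close>

definition volume_form_on ::
  "('k::real_normed_field ^ 4) set \<Rightarrow> 'k metric4 \<Rightarrow> ('k ^ 4 \<Rightarrow> 'k) \<Rightarrow> bool" where
  "volume_form_on S g \<omega> \<longleftrightarrow> smooth_on S \<omega> \<and> (\<forall>p\<in>S. (\<omega> p)\<^sup>2 = det (g p))"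

definition hodge4 :: "'k::field ^ 4 ^ 4 \<Rightarrow> 'k \<Rightarrow> (4 \<Rightarrow> 4 \<Rightarrow> 'k) \<Rightarrow> 4 \<Rightarrow> 4 \<Rightarrow> 'k" where
  "hodge4 G w F i j =
     (\<Sum>m\<in>UNIV. \<Sum>n\<in>UNIV. \<Sum>a\<in>UNIV. \<Sum>b\<in>UNIV.
        w * levi_civita i j m n * matrix_inv G $ m $ a * matrix_inv G $ n $ b * F a b) / 2"

definition weyl_self_dual_part ::
  "'k::real_normed_field metric4 \<Rightarrow> ('k ^ 4 \<Rightarrow> 'k) \<Rightarrow> 4 \<Rightarrow> 4 \<Rightarrow> 4 \<Rightarrow> 4 \<Rightarrow> 'k ^ 4 \<Rightarrow> 'k" where
  "weyl_self_dual_part g \<omega> i j k l p =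
     (weyl g i j k l p + hodge4 (g p) (\<omega> p) (\<lambda>a b. weyl g a b k l p) i j) / 2"

definition anti_self_dual_on ::
  "('k::real_normed_field ^ 4) set \<Rightarrow> 'k metric4 \<Rightarrow> bool" where
  "anti_self_dual_on S g \<longleftrightarrow>
     (\<exists>\<omega>. volume_form_on S g \<omega> \<and>
          (\<forall>p\<in>S. \<forall>i j k l. weyl_self_dual_part g \<omega> i j k l p = 0))"

definition lie_deriv_metric ::
  "('k::real_normed_field ^ 4 \<Rightarrow> 'k ^ 4) \<Rightarrow> 'k metric4 \<Rightarrow> 'k metric4" where
  "lie_deriv_metric X g p =
     (\<chi> i j. \<Sum>k\<in>UNIV. X p $ k * partial_deriv k (\<lambda>q. g q $ i $ j) p
        + g p $ k $ j * partial_deriv i (\<lambda>q. X q $ k) p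
        + g p $ i $ k * partial_deriv j (\<lambda>q. X q $ k) p)"

definition killing_field_on ::
  "('k::real_normed_field ^ 4) set \<Rightarrow> ('k ^ 4 \<Rightarrow> 'k ^ 4) \<Rightarrow> 'k metric4 \<Rightarrow> bool" where
  "killing_field_on S X g \<longleftrightarrow>
     (\<forall>i. smooth_on S (\<lambda>p. X p $ i)) \<and> (\<forall>p\<in>S. lie_deriv_metric X g p = 0)"

section \<open>The dKP Einstein--Weyl structure\<close>

text \<open>The coordinates \<open>x, y, t\<close> are those with index \<open>1, 2, 3\<close>.\<close>

abbreviation dx :: "'k::real_normed_field ^ 3" where "dx \<equiv> axis 1 1"
abbreviation dy :: "'k::real_normed_field ^ 3" where "dy \<equiv> axis 2 1"
abbreviation dt :: "'k::real_normed_field ^ 3" where "dt \<equiv> axis 3 1"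

abbreviation D\<^sub>x :: "('k::real_normed_field ^ 3 \<Rightarrow> 'k) \<Rightarrow> 'k ^ 3 \<Rightarrow> 'k" where
  "D\<^sub>x \<equiv> partial_deriv 1"
abbreviation D\<^sub>y :: "('k::real_normed_field ^ 3 \<Rightarrow> 'k) \<Rightarrow> 'k ^ 3 \<Rightarrow> 'k" where
  "D\<^sub>y \<equiv> partial_deriv 2"
abbreviation D\<^sub>t :: "('k::real_normed_field ^ 3 \<Rightarrow> 'k) \<Rightarrow> 'k ^ 3 \<Rightarrow> 'k" where
  "D\<^sub>t \<equiv> partial_deriv 3"

definition dKP_on ::
  "('k::real_normed_field ^ 3) set \<Rightarrow> ('k ^ 3 \<Rightarrow> 'k) \<Rightarrow> bool" where
  "dKP_on U u \<longleftrightarrow>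
     (\<forall>p\<in>U. D\<^sub>x (\<lambda>q. D\<^sub>t u q - u q * D\<^sub>x u q) p = D\<^sub>y (D\<^sub>y u) p)"

definition linearised_dKP_on ::
  "('k::real_normed_field ^ 3) set \<Rightarrow> ('k ^ 3 \<Rightarrow> 'k) \<Rightarrow> ('k ^ 3 \<Rightarrow> 'k) \<Rightarrow> bool" where
  "linearised_dKP_on U u V \<longleftrightarrow>
     (\<forall>p\<in>U. D\<^sub>y (D\<^sub>y V) p - D\<^sub>t (D\<^sub>x V) p + u p * D\<^sub>x (D\<^sub>x V) p
            + 2 * D\<^sub>x u p * D\<^sub>x V p + D\<^sub>x (D\<^sub>x u) p * V p = 0)"

definition dKP_metric ::
  "('k::real_normed_field ^ 3 \<Rightarrow> 'k) \<Rightarrow> 'k ^ 3 \<Rightarrow> 'k ^ 3 ^ 3" where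
  "dKP_metric u p = sym_prod dy dy - 4 *\<^sub>t sym_prod dx dt - (4 * u p) *\<^sub>t sym_prod dt dt"

definition dKP_one_form ::
  "('k::real_normed_field ^ 3 \<Rightarrow> 'k) \<Rightarrow> 'k ^ 3 \<Rightarrow> 'k ^ 3" where
  "dKP_one_form u p = (- 4 * D\<^sub>x u p) *s dt"

text \<open>
  The Hodge operator of \<open>dKP_metric u\<close> on one-forms at \<open>p\<close>, for the volume form
  \<open>2 dx \<and> dy \<and> dt\<close>.
\<close>

definition dKP_hodge ::
  "('k::real_normed_field ^ 3 \<Rightarrow> 'k) \<Rightarrow> 'k ^ 3 \<Rightarrow> 'k ^ 3 \<Rightarrow> 'k ^ 3 ^ 3" where
  "dKP_hodge u p a =
     (a $ 1) *\<^sub>t (wedge dy dx + (2 * u p) *\<^sub>t wedge dy dt)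
     + (a $ 2) *\<^sub>t (2 *\<^sub>t wedge dt dx)
     + (a $ 3) *\<^sub>t wedge dt dy"

definition monopole_on ::
  "('k::real_normed_field ^ 3) set \<Rightarrow> ('k ^ 3 \<Rightarrow> 'k) \<Rightarrow> ('k ^ 3 \<Rightarrow> 'k) \<Rightarrow>
     ('k ^ 3 \<Rightarrow> 'k ^ 3) \<Rightarrow> bool" where
  "monopole_on W u V \<alpha> \<longleftrightarrow>
     (\<forall>p\<in>W. dKP_hodge u p (ext_deriv0 V p + (1 / 2 * V p) *s dKP_one_form u p)
            = ext_deriv1 \<alpha> p)"

text \<open>
  The total space has coordinates \<open>x, y, t, z\<close> with index \<open>1, 2, 3, 4\<close>. Tensors on the
  base are pulled back along the linear projection \<open>base_proj\<close>.
\<close>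

definition base_proj :: "'k::real_normed_field ^ 4 \<Rightarrow> 'k ^ 3" where
  "base_proj p = vector [p $ 1, p $ 2, p $ 3]"

definition pull_back1 :: "'k::real_normed_field ^ 3 \<Rightarrow> 'k ^ 4" where
  "pull_back1 a = a v* matrix base_proj"

definition pull_back2 :: "'k::real_normed_field ^ 3 ^ 3 \<Rightarrow> 'k ^ 4 ^ 4" where
  "pull_back2 A = transpose (matrix base_proj) ** A ** matrix base_proj"

abbreviation dz :: "'k::real_normed_field ^ 4" where "dz \<equiv> axis 4 1"

definition del_z :: "'k::real_normed_field ^ 4 \<Rightarrow> 'k ^ 4" where
  "del_z p = axis 4 1"

definition dKP_monopole_metric ::
  "('k::real_normed_field ^ 3 \<Rightarrow> 'k) \<Rightarrow> ('k ^ 3 \<Rightarrow> 'k) \<Rightarrow> ('k ^ 3 \<Rightarrow> 'k ^ 3) \<Rightarrow> 'k metric4" where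
  "dKP_monopole_metric u V \<alpha> p =
     (let q = base_proj p; \<theta> = dz + pull_back1 (\<alpha> q)
      in V q *\<^sub>t pull_back2 (dKP_metric u q) - inverse (V q) *\<^sub>t sym_prod \<theta> \<theta>)"

end

theory Submission
  imports Defs
begin

text \<open>
  The metric \<open>g\<close> carries a parallel null two-form, and this makes its self-dual curvature almost
  trivial. In a suitable null coframe with \<open>g = 2 (m\<^sub>1 m\<^sub>2 - m\<^sub>3 m\<^sub>4)\<close> (lemma \<open>dKP_monopole_metric_eq\<close>) the
  connection one-forms split into a self-dual and an anti-self-dual triple. The monopole equation,
  which fixes \<open>d\<alpha>\<close>, makes two of the three self-dual connection forms vanish; this is the content of
  \<open>torsion_identity\<close>, the check of Cartan's first structure equation for an explicit connection
  matrix. The remaining self-dual form \<open>w\<^sub>2\<^sub>3\<close> is nilpotent, so the self-dual half of the curvature is just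
  \<open>d w\<^sub>2\<^sub>3\<close>. By the pair symmetry of the Riemann tensor its self-dual part has the single component
  \<open>d w\<^sub>2\<^sub>3 (e\<^sub>2, e\<^sub>3)\<close>, and this is a multiple of the dKP equation (\<open>curv_2323\<close>). Hence the scalar curvature and
  the self-dual Weyl tensor vanish, for the orientation in which \<open>m\<^sub>2 \<and> m\<^sub>3\<close> is self-dual
  (\<open>weyl_frame_self_dual_part\<close>).

  To connect this with the curvature defined through Christoffel symbols, the locale \<open>moving_frame\<close>
  shows that a metric and torsion-free connection matrix in a frame is the Levi-Civita connection
  (\<open>christoffel_eq\<close>), that its curvature is the Riemann tensor (\<open>riemann_up_eq\<close>), and that the Weyl
  tensor and the Hodge operator may be evaluated on the frame (\<open>weyl_self_dual_part_vanishes\<close>).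

  The potential \<open>\<alpha>\<close> exists locally because the linearised dKP equation says exactly that
  the left-hand side of the monopole equation is a closed two-form (\<open>monopole_local_solution\<close>). The
  Poincare lemma and the symmetry of second derivatives are derived from antiderivatives along
  coordinate segments with a real parameter, which works over the real and the complex numbers alike.
  The Killing property is the fact that no component of \<open>g\<close> depends on \<open>z\<close>.
\<close>

section \<open>Partial derivatives\<close>

text \<open>
  The relational form of \<open>partial_deriv\<close>: since \<open>deriv\<close> returns an arbitrary value where no derivative
  exists, the calculus rules are only compositional for a predicate that includes differentiability.
\<close>

definition has_partial ::
  "'n::finite \<Rightarrow> ('k::real_normed_field ^ 'n \<Rightarrow> 'k) \<Rightarrow> 'k \<Rightarrow> 'k ^ 'n \<Rightarrow> bool" where
  "has_partial i f d p \<longleftrightarrow> ((\<lambda>s. f (p + s *s axis i 1)) has_field_derivative d) (at 0)"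

lemma partial_deriv_eq: "has_partial i f d p \<Longrightarrow> partial_deriv i f p = d"
  unfolding has_partial_def partial_deriv_def by (rule DERIV_imp_deriv)

lemma has_partial_const [intro]: "has_partial i (\<lambda>q. c) 0 p"
  unfolding has_partial_def by simp

lemma has_partial_add [intro]:
  "has_partial i f f' p \<Longrightarrow> has_partial i g g' p \<Longrightarrow> has_partial i (\<lambda>q. f q + g q) (f' + g') p"
  unfolding has_partial_def by (rule DERIV_add)

lemma has_partial_minus [intro]:
  "has_partial i f f' p \<Longrightarrow> has_partial i (\<lambda>q. - f q) (- f') p"
  unfolding has_partial_def by (rule DERIV_minus)

lemma has_partial_diff [intro]:
  "has_partial i f f' p \<Longrightarrow> has_partial i g g' p \<Longrightarrow> has_partial i (\<lambda>q. f q - g q) (f' - g') p"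
  unfolding has_partial_def by (rule DERIV_diff)

lemma has_partial_mult [intro]:
  "has_partial i f f' p \<Longrightarrow> has_partial i g g' p \<Longrightarrow>
   has_partial i (\<lambda>q. f q * g q) (f' * g p + f p * g') p"
  unfolding has_partial_def by (drule (1) DERIV_mult) (simp add: algebra_simps)

lemma has_partial_inverse [intro]:
  assumes "has_partial i f f' p" "f p \<noteq> 0"
  shows "has_partial i (\<lambda>q. inverse (f q)) (- (f' * (inverse (f p) * inverse (f p)))) p"
  using DERIV_inverse_fun[of "\<lambda>s. f (p + s *s axis i 1)" f' 0 UNIV] assms
  by (simp add: has_partial_def algebra_simps)

lemma has_partial_sum [intro]:
  "(\<And>a. a \<in> A \<Longrightarrow> has_partial i (f a) (f' a) p) \<Longrightarrow>
   has_partial i (\<lambda>q. \<Sum>a\<in>A. f a q) (\<Sum>a\<in>A. f' a) p"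
  unfolding has_partial_def by (rule DERIV_sum)

lemma continuous_line:
  "continuous_on UNIV (\<lambda>s::'k::real_normed_field. (p::'k^'n::finite) + s *s axis i 1)"
proof -
  have "p + s *s axis i 1 = (\<chi> j. p $ j + s * axis i 1 $ j)" for s
    by (simp add: vec_eq_iff)
  then show ?thesis by (auto intro!: continuous_intros)
qed

lemma has_partial_cong_open:
  assumes "open S" "p \<in> S" "\<And>q. q \<in> S \<Longrightarrow> f q = g q"
  shows "has_partial i f d p \<longleftrightarrow> has_partial i g d p"
proof -
  have "open ((\<lambda>s::'a. p + s *s axis i 1) -` S)"
    by (rule open_vimage[OF \<open>open S\<close> continuous_line])
  moreover have "0 \<in> (\<lambda>s::'a. p + s *s axis i 1) -` S" using \<open>p \<in> S\<close> by simp
  ultimately have "eventually (\<lambda>s. s \<in> (\<lambda>s::'a. p + s *s axis i 1) -` S) (nhds 0)"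
    by (rule eventually_nhds_in_open)
  then have "eventually (\<lambda>s. f (p + s *s axis i 1) = g (p + s *s axis i 1)) (nhds 0)"
    by eventually_elim (use assms(3) in auto)
  then show ?thesis unfolding has_partial_def by (intro DERIV_cong_ev refl) auto
qed

lemma partial_deriv_cong_open:
  assumes "open S" "p \<in> S" "\<And>q. q \<in> S \<Longrightarrow> f q = g q"
  shows "partial_deriv i f p = partial_deriv i g p"
proof -
  have "has_partial i f d p \<longleftrightarrow> has_partial i g d p" for d
    by (rule has_partial_cong_open[OF assms])
  then show ?thesis unfolding partial_deriv_def deriv_def has_partial_def by simp
qed

lemma has_partial_shift:
  "has_partial i f d (p + c *s axis i 1) \<longleftrightarrow>
   ((\<lambda>s. f (p + s *s axis i 1)) has_field_derivative d) (at c)"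
  using DERIV_shift[of "\<lambda>s. f (p + s *s axis i 1)" d 0 c]
  by (simp add: has_partial_def vector_add_ldistrib vector_sadd_rdistrib add.commute add.left_commute add.assoc)

section \<open>Smooth functions\<close>

lemma Ck_on_continuous: "Ck_on k S f \<Longrightarrow> continuous_on S f"
  by (cases k) auto

lemma Ck_on_has_partial:
  "Ck_on (Suc k) S f \<Longrightarrow> p \<in> S \<Longrightarrow> has_partial i f (partial_deriv i f p) p"
  by (simp add: has_partial_def partial_deriv_def DERIV_deriv_iff_field_differentiable)

text \<open>
  Openness of the set is essential: a partial derivative at a point sees the values of the function
  on a whole neighbourhood of it.
\<close>

lemma Ck_on_cong:
  assumes "open S" "\<And>q. q \<in> S \<Longrightarrow> f q = g q"
  shows "Ck_on k S f \<longleftrightarrow> Ck_on k S g"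
  using assms(2)
proof (induction k arbitrary: f g)
  case 0
  then show ?case using continuous_on_cong[of S S f g] by simp
next
  case (Suc k)
  have *: "Ck_on k S (partial_deriv i f) \<longleftrightarrow> Ck_on k S (partial_deriv i g)" for i
    by (rule Suc.IH) (auto intro!: partial_deriv_cong_open[of S _ f g i] assms(1) Suc.prems)
  have **: "(\<lambda>s. f (p + s *s axis i 1)) field_differentiable (at 0) \<longleftrightarrow>
     (\<lambda>s. g (p + s *s axis i 1)) field_differentiable (at 0)" if "p \<in> S" for i p
  proof -
    have "has_partial i f d p \<longleftrightarrow> has_partial i g d p" for d
      by (rule has_partial_cong_open[OF assms(1) that Suc.prems])
    then show ?thesis by (simp add: field_differentiable_def has_partial_def)
  qed
  have "continuous_on S f \<longleftrightarrow> continuous_on S g"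
    using Suc.prems by (intro continuous_on_cong) auto
  then show ?case using * ** by auto
qed

lemma Ck_on_SucI:
  assumes "open S" "continuous_on S f"
    and f': "\<And>i p. p \<in> S \<Longrightarrow> has_partial i f (f' i p) p"
    and "\<And>i. Ck_on k S (f' i)"
  shows "Ck_on (Suc k) S f"
proof -
  have "Ck_on k S (partial_deriv i f) \<longleftrightarrow> Ck_on k S (f' i)" for i
    by (rule Ck_on_cong[OF assms(1)]) (rule partial_deriv_eq[OF f'])
  then have "Ck_on k S (partial_deriv i f)" for i
    using assms(4) by blast
  then show ?thesis
    using assms(2,3) unfolding has_partial_def Ck_on.simps(2) field_differentiable_def by blast
qed

lemma Ck_on_SucD: "Ck_on (Suc k) S f \<Longrightarrow> Ck_on k S f"
proof (induction k arbitrary: f)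
  case (Suc k)
  have "Ck_on (Suc k) S (partial_deriv i f)" for i
    using Suc.prems by simp
  then have "Ck_on k S (partial_deriv i f)" for i
    using Suc.IH by blast
  then show ?case using Suc.prems by simp
qed simp

lemma Ck_on_const: "open S \<Longrightarrow> Ck_on k S (\<lambda>p. c)"
proof (induction k arbitrary: c)
  case (Suc k)
  show ?case
    by (rule Ck_on_SucI[where f'="\<lambda>i p. 0"])
      (use Suc in \<open>auto simp: continuous_on_const\<close>)
qed simp

lemma Ck_on_add: "open S \<Longrightarrow> Ck_on k S f \<Longrightarrow> Ck_on k S g \<Longrightarrow> Ck_on k S (\<lambda>p. f p + g p)"
proof (induction k arbitrary: f g)
  case (Suc k)
  show ?case
  proof (rule Ck_on_SucI[where f'="\<lambda>i p. partial_deriv i f p + partial_deriv i g p"])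
    show "continuous_on S (\<lambda>p. f p + g p)"
      using Suc.prems by (intro continuous_intros Ck_on_continuous)
    show "has_partial i (\<lambda>p. f p + g p) (partial_deriv i f p + partial_deriv i g p) p"
      if "p \<in> S" for i p
      using Suc.prems that by (intro has_partial_add Ck_on_has_partial)
  qed (use Suc in simp_all)
qed (auto intro: continuous_intros)

lemma Ck_on_mult: "open S \<Longrightarrow> Ck_on k S f \<Longrightarrow> Ck_on k S g \<Longrightarrow> Ck_on k S (\<lambda>p. f p * g p)"
proof (induction k arbitrary: f g)
  case (Suc k)
  show ?case
  proof (rule Ck_on_SucI[where f'="\<lambda>i p. partial_deriv i f p * g p + f p * partial_deriv i g p"])
    show "continuous_on S (\<lambda>p. f p * g p)"
      using Suc.prems by (intro continuous_intros Ck_on_continuous)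
    show "has_partial i (\<lambda>p. f p * g p) (partial_deriv i f p * g p + f p * partial_deriv i g p) p"
      if "p \<in> S" for i p
      using Suc.prems that by (intro has_partial_mult Ck_on_has_partial)
    have "Ck_on k S (partial_deriv i f)" "Ck_on k S (partial_deriv i g)" for i
      using Suc.prems by simp_all
    then show "Ck_on k S (\<lambda>p. partial_deriv i f p * g p + f p * partial_deriv i g p)" for i
      using Suc.prems by (intro Ck_on_add Suc.IH Ck_on_SucD[OF Suc.prems(2)] Ck_on_SucD[OF Suc.prems(3)])
  qed (use Suc in simp_all)
qed (auto intro: continuous_intros)

lemma Ck_on_inverse:
  "open S \<Longrightarrow> Ck_on k S f \<Longrightarrow> \<forall>p\<in>S. f p \<noteq> 0 \<Longrightarrow> Ck_on k S (\<lambda>p. inverse (f p))"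
proof (induction k arbitrary: f)
  case (Suc k)
  have inv: "Ck_on k S (\<lambda>p. inverse (f p))"
    using Suc.IH Suc.prems Ck_on_SucD by blast
  have neg: "Ck_on k S (\<lambda>p. (-1) * (partial_deriv i f p * (inverse (f p) * inverse (f p))))" for i
    using Suc.prems inv by (intro Ck_on_mult Ck_on_const) auto
  show ?case
  proof (rule Ck_on_SucI[where f'="\<lambda>i p. - (partial_deriv i f p * (inverse (f p) * inverse (f p)))"])
    show "continuous_on S (\<lambda>p. inverse (f p))"
      using inv by (rule Ck_on_continuous)
    show "has_partial i (\<lambda>p. inverse (f p)) (- (partial_deriv i f p * (inverse (f p) * inverse (f p)))) p"
      if "p \<in> S" for i p
      using Suc.prems that by (intro has_partial_inverse Ck_on_has_partial) auto
  qed (use Suc.prems neg in simp_all)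
qed (auto intro: continuous_intros)

lemma smooth_on_const: "open S \<Longrightarrow> smooth_on S (\<lambda>p. c)"
  and smooth_on_add: "open S \<Longrightarrow> smooth_on S f \<Longrightarrow> smooth_on S g \<Longrightarrow> smooth_on S (\<lambda>p. f p + g p)"
  and smooth_on_mult: "open S \<Longrightarrow> smooth_on S f \<Longrightarrow> smooth_on S g \<Longrightarrow> smooth_on S (\<lambda>p. f p * g p)"
  and smooth_on_inverse: "open S \<Longrightarrow> smooth_on S f \<Longrightarrow> \<forall>p\<in>S. f p \<noteq> 0 \<Longrightarrow> smooth_on S (\<lambda>p. inverse (f p))"
  and smooth_on_cong: "open S \<Longrightarrow> (\<And>q. q \<in> S \<Longrightarrow> f q = g q) \<Longrightarrow> smooth_on S f \<longleftrightarrow> smooth_on S g"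
  unfolding smooth_on_def
  by (simp_all add: Ck_on_const Ck_on_add Ck_on_mult Ck_on_inverse Ck_on_cong[of S f g])

lemma smooth_on_minus: "open S \<Longrightarrow> smooth_on S f \<Longrightarrow> smooth_on S (\<lambda>p. - f p)"
  using smooth_on_mult[OF _ smooth_on_const[of S "-1"], of f] by simp

lemma smooth_on_diff:
  "open S \<Longrightarrow> smooth_on S f \<Longrightarrow> smooth_on S g \<Longrightarrow> smooth_on S (\<lambda>p. f p - g p)"
  using smooth_on_add[OF _ _ smooth_on_minus, of S f g] by simp

lemma smooth_on_divide:
  "open S \<Longrightarrow> smooth_on S f \<Longrightarrow> smooth_on S g \<Longrightarrow> \<forall>p\<in>S. g p \<noteq> 0 \<Longrightarrow> smooth_on S (\<lambda>p. f p / g p)"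
  by (simp add: divide_inverse smooth_on_mult smooth_on_inverse)

lemma smooth_on_sum:
  "open S \<Longrightarrow> (\<And>a. a \<in> A \<Longrightarrow> smooth_on S (f a)) \<Longrightarrow> smooth_on S (\<lambda>p. \<Sum>a\<in>A. f a p)"
  by (induction A rule: infinite_finite_induct) (auto intro: smooth_on_const smooth_on_add)

lemma smooth_on_partial: "smooth_on S f \<Longrightarrow> smooth_on S (partial_deriv i f)"
  unfolding smooth_on_def using Ck_on.simps(2) by blast

lemma smooth_on_has_partial:
  "smooth_on S f \<Longrightarrow> p \<in> S \<Longrightarrow> has_partial i f (partial_deriv i f p) p"
  unfolding smooth_on_def using Ck_on_has_partial by blast

lemma smooth_on_subset: "smooth_on S f \<Longrightarrow> T \<subseteq> S \<Longrightarrow> smooth_on T f"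
proof -
  have "Ck_on k S f \<Longrightarrow> T \<subseteq> S \<Longrightarrow> Ck_on k T f" for k
    by (induction k arbitrary: f) (auto intro: continuous_on_subset)
  then show "smooth_on S f \<Longrightarrow> T \<subseteq> S \<Longrightarrow> smooth_on T f" unfolding smooth_on_def by blast
qed

lemma smooth_on_continuous: "smooth_on S f \<Longrightarrow> continuous_on S f"
  unfolding smooth_on_def using Ck_on_continuous by blast

section \<open>Antiderivatives along a coordinate\<close>

text \<open>
  All integrals below run over the real parameter \<open>t\<close> that moves the \<open>i\<close>-th coordinate linearly from its
  value at the base point to its value at \<open>q\<close>. Keeping the parameter real and multiplying by the
  scalar increment \<open>q $ i - p $ i\<close> is what lets the real and the holomorphic case be treated at once:
  over the complex numbers \<open>antideriv\<close> is the path integral along a straight segment.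
\<close>

definition slide :: "'k::real_normed_field ^ 'n::finite \<Rightarrow> 'n \<Rightarrow> real \<Rightarrow> 'k ^ 'n \<Rightarrow> 'k ^ 'n" where
  "slide p i t q = (\<chi> j. if j = i then p $ i + of_real t * (q $ i - p $ i) else q $ j)"

definition coord_star :: "'k::real_normed_field ^ 'n::finite \<Rightarrow> ('k ^ 'n) set \<Rightarrow> bool" where
  "coord_star p S \<longleftrightarrow> open S \<and> p \<in> S \<and> (\<forall>i. \<forall>t\<in>{0..1}. \<forall>q\<in>S. slide p i t q \<in> S)"

definition antideriv ::
  "'k::{real_normed_field, euclidean_space} ^ 'n::finite \<Rightarrow> 'n \<Rightarrow> ('k ^ 'n \<Rightarrow> 'k) \<Rightarrow> 'k ^ 'n \<Rightarrow> 'k" where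
  "antideriv p i f q = integral {0..1} (\<lambda>t. f (slide p i t q) * (q $ i - p $ i))"

lemma slide_axis:
  "slide p i t (q + s *s axis j 1) =
   slide p i t q + (if j = i then of_real t * s else s) *s axis j 1"
  by (auto simp: vec_eq_iff slide_def axis_def algebra_simps)

lemma slide_1 [simp]: "slide p i 1 q = q"
  by (auto simp: vec_eq_iff slide_def)

lemma continuous_slide: "continuous_on UNIV (\<lambda>(q, t). slide p i t q)"
proof -
  have "continuous_on UNIV (\<lambda>x. (\<chi> j. if j = i then p $ i + of_real (snd x) * (fst x $ i - p $ i) else fst x $ j))"
  proof (rule continuous_on_vec_lambda)
    fix j
    show "continuous_on UNIV (\<lambda>x. if j = i then p $ i + of_real (snd x) * (fst x $ i - p $ i) else fst x $ j)"
      by (cases "j = i") (auto intro!: continuous_intros)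
  qed
  then show ?thesis by (simp add: case_prod_unfold slide_def)
qed

text \<open>
  A ball works, because sliding a coordinate towards the centre shrinks the modulus of one
  component of the displacement and keeps the others.
\<close>

lemma coord_star_exists:
  fixes p :: "'k::real_normed_field ^ 'n::finite"
  assumes "open U" "p \<in> U"
  obtains S where "coord_star p S" "S \<subseteq> U"
proof -
  obtain e where e: "e > 0" "ball p e \<subseteq> U" using assms open_contains_ball by blast
  have le: "dist p (slide p i t q) \<le> dist p q" if "t \<in> {0..1}" for i t q
  proof -
    have "norm ((p - slide p i t q) $ j) \<le> norm ((p - q) $ j)" for j
    proof (cases "j = i")
      case True
      then have "(p - slide p i t q) $ j = of_real t * ((p - q) $ j)"
        by (simp add: slide_def algebra_simps)
      then show ?thesis using that by (simp add: norm_mult mult_left_le_one_le)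
    qed (simp add: slide_def)
    then show ?thesis unfolding dist_norm norm_vec_def by (intro L2_set_mono) auto
  qed
  then have "coord_star p (ball p e)"
    unfolding coord_star_def using e(1) by (auto intro!: le_less_trans[OF le])
  then show ?thesis using that e(2) by blast
qed

lemma continuous_on_slide_comp:
  assumes "coord_star p S" "continuous_on S f"
  shows "continuous_on (S \<times> {0..1}) (\<lambda>(q, t). f (slide p i t q))"
proof -
  have "continuous_on (S \<times> {0..1}) (f \<circ> (\<lambda>(q, t). slide p i t q))"
    by (rule continuous_on_compose)
      (use assms in \<open>auto intro: continuous_on_subset[OF continuous_slide] continuous_on_subset
        simp: coord_star_def image_def\<close>)
  then show ?thesis by (simp add: o_def case_prod_unfold)
qed

lemma continuous_antideriv:
  assumes "coord_star p S" "continuous_on S f"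
  shows "continuous_on S (antideriv p i f)"
proof -
  have "continuous_on (S \<times> cbox 0 1) (\<lambda>(q, t). f (slide p i t q) * (q $ i - p $ i))"
    using continuous_on_slide_comp[OF assms, of i]
    by (auto intro!: continuous_intros simp: case_prod_unfold)
  from integral_continuous_on_param[OF this] show ?thesis
    unfolding antideriv_def cbox_interval .
qed

text \<open>
  Along the real segment, a derivative with respect to the scalar field is in particular a derivative
  with respect to the real parameter, so the fundamental theorem of calculus becomes available.
\<close>

lemma slide_has_vector_derivative:
  assumes "has_partial i f d (slide p i t q)"
  shows "((\<lambda>t. f (slide p i t q)) has_vector_derivative d * (q $ i - p $ i)) (at t within T)"
proof -
  have eq: "slide p i t' q = slide p i t q + (of_real (t' - t) * (q $ i - p $ i)) *s axis i 1" for t'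
    by (auto simp: vec_eq_iff slide_def axis_def algebra_simps)
  have "((\<lambda>t'. of_real (t' - t) * (q $ i - p $ i)) has_vector_derivative (q $ i - p $ i)) (at t)"
    by (auto intro!: derivative_eq_intros simp: has_vector_derivative_def scaleR_conv_of_real)
  moreover have "((\<lambda>s. f (slide p i t q + s *s axis i 1)) has_field_derivative d)
      (at (of_real (t - t) * (q $ i - p $ i)))"
    using assms by (simp add: has_partial_def)
  ultimately have "((\<lambda>s. f (slide p i t q + s *s axis i 1)) \<circ> (\<lambda>t'. of_real (t' - t) * (q $ i - p $ i))
      has_vector_derivative (q $ i - p $ i) * d) (at t)"
    by (rule field_vector_diff_chain_at)
  then show ?thesis
    unfolding o_def eq[symmetric] by (simp add: mult.commute has_vector_derivative_at_within)
qed

lemma antideriv_partial: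
  assumes "coord_star p S" "q \<in> S"
    and f: "\<And>q. q \<in> S \<Longrightarrow> has_partial i f (f' q) q"
  shows "antideriv p i f' q = f q - f (slide p i 0 q)"
proof -
  have "((\<lambda>t. f' (slide p i t q) * (q $ i - p $ i)) has_integral
      (f (slide p i 1 q) - f (slide p i 0 q))) {0..1}"
    using assms by (intro fundamental_theorem_of_calculus slide_has_vector_derivative)
      (auto simp: coord_star_def)
  then show ?thesis unfolding antideriv_def slide_1 by (rule integral_unique)
qed

text \<open>
  Differentiation under the integral sign. The two cases \<open>j = i\<close> and \<open>j \<noteq> i\<close> share this proof: moving
  \<open>q\<close> by \<open>s\<close> in direction \<open>j\<close> moves the point on the segment by \<open>t s\<close> or by \<open>s\<close>, and moves the length
  of the segment by \<open>s\<close> or not at all.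
\<close>

lemma has_partial_antideriv:
  assumes S: "coord_star p S" "q \<in> S"
    and f: "\<And>q. q \<in> S \<Longrightarrow> has_partial j f (f' q) q" "continuous_on S f" "continuous_on S f'"
  shows "has_partial j (antideriv p i f)
     (integral {0..1} (\<lambda>t. f' (slide p i t q) * (if j = i then of_real t else 1) * (q $ i - p $ i)
        + f (slide p i t q) * (if j = i then 1 else 0))) q"
proof -
  define c :: "real \<Rightarrow> 'a" where "c t = (if j = i then of_real t else 1)" for t
  define \<delta> :: 'a where "\<delta> = (if j = i then 1 else 0)"
  define h where "h s t = f' (slide p i t (q + s *s axis j 1)) * c t * (q $ i + s * \<delta> - p $ i)
        + f (slide p i t (q + s *s axis j 1)) * \<delta>" for s t
  define N where "N = (\<lambda>s::'a. q + s *s axis j 1) -` S"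
  have "open N" unfolding N_def
    using S by (intro open_vimage continuous_line) (auto simp: coord_star_def)
  moreover have "0 \<in> N" using S by (simp add: N_def)
  ultimately obtain e where e: "e > 0" "ball 0 e \<subseteq> N" using open_contains_ball by blast
  have cont_slide: "continuous_on (ball 0 e \<times> cbox 0 1) (\<lambda>(s, t). g (slide p i t (q + s *s axis j 1)))"
    if "continuous_on S g" for g :: "'a ^ 'b \<Rightarrow> 'a"
  proof -
    have "continuous_on (ball 0 e \<times> cbox 0 1)
        ((\<lambda>(q, t). g (slide p i t q)) \<circ> (\<lambda>(s, t). (q + s *s axis j 1, t)))"
    proof (rule continuous_on_compose)
      have "continuous_on (ball 0 e \<times> cbox 0 (1::real)) (\<lambda>x. q + fst x *s axis j 1)"
        by (rule continuous_on_compose2[OF continuous_line]) (auto intro!: continuous_intros)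
      then show "continuous_on (ball 0 e \<times> cbox 0 (1::real)) (\<lambda>(s, t). (q + s *s axis j 1, t))"
        by (auto intro!: continuous_intros simp: case_prod_unfold)
      show "continuous_on ((\<lambda>(s, t). (q + s *s axis j 1, t)) ` (ball 0 e \<times> cbox 0 (1::real)))
          (\<lambda>(q, t). g (slide p i t q))"
        by (rule continuous_on_subset[OF continuous_on_slide_comp[OF S(1) that]])
          (use e in \<open>auto simp: N_def\<close>)
    qed
    then show ?thesis by (simp add: o_def case_prod_unfold)
  qed
  have "((\<lambda>s. integral (cbox 0 1) (\<lambda>t. f (slide p i t (q + s *s axis j 1)) * (q $ i + s * \<delta> - p $ i)))
      has_field_derivative integral (cbox 0 1) (h 0)) (at 0 within ball 0 e)"
  proof (rule leibniz_rule_field_derivative)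
    fix s :: 'a and t :: real assume st: "s \<in> ball 0 e" "t \<in> cbox 0 1"
    have "q + s *s axis j 1 \<in> S" using e st by (auto simp: N_def)
    then have "slide p i t (q + s *s axis j 1) \<in> S" using S(1) st by (auto simp: coord_star_def)
    then have "has_partial j f (f' (slide p i t (q + s *s axis j 1))) (slide p i t q + (c t * s) *s axis j 1)"
      using f(1) by (simp add: slide_axis c_def split: if_splits)
    then have "((\<lambda>s. f (slide p i t q + s *s axis j 1)) has_field_derivative f' (slide p i t (q + s *s axis j 1))) (at (c t * s))"
      by (simp add: has_partial_shift)
    moreover have "((\<lambda>s. c t * s) has_field_derivative c t) (at s)"
      by (auto intro!: derivative_eq_intros)
    ultimately have "((\<lambda>s. f (slide p i t q + (c t * s) *s axis j 1)) has_field_derivative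
        f' (slide p i t (q + s *s axis j 1)) * c t) (at s)"
      by (rule DERIV_chain2)
    moreover have "slide p i t q + (c t * s) *s axis j 1 = slide p i t (q + s *s axis j 1)" for s
      by (simp add: slide_axis c_def)
    ultimately have "((\<lambda>s. f (slide p i t (q + s *s axis j 1))) has_field_derivative
        f' (slide p i t (q + s *s axis j 1)) * c t) (at s)"
      by simp
    moreover have "((\<lambda>s. q $ i + s * \<delta> - p $ i) has_field_derivative \<delta>) (at s)"
      by (auto intro!: derivative_eq_intros)
    ultimately have "((\<lambda>s. f (slide p i t (q + s *s axis j 1)) * (q $ i + s * \<delta> - p $ i)) has_field_derivative
        f' (slide p i t (q + s *s axis j 1)) * c t * (q $ i + s * \<delta> - p $ i)
        + \<delta> * f (slide p i t (q + s *s axis j 1))) (at s)"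
      by (rule DERIV_mult)
    then show "((\<lambda>s. f (slide p i t (q + s *s axis j 1)) * (q $ i + s * \<delta> - p $ i)) has_field_derivative h s t)
        (at s within ball 0 e)"
      unfolding h_def by (simp add: mult.commute has_field_derivative_at_within)
  next
    have "continuous_on (ball 0 e \<times> cbox 0 1) (\<lambda>(s, t). f (slide p i t (q + s *s axis j 1)) * (q $ i + s * \<delta> - p $ i))"
      using cont_slide[OF f(2)] by (auto intro!: continuous_intros simp: case_prod_unfold)
    then have "continuous_on (cbox 0 1) (\<lambda>t. f (slide p i t (q + s *s axis j 1)) * (q $ i + s * \<delta> - p $ i))"
      if "s \<in> ball 0 e" for s
    proof -
      assume cont: "continuous_on (ball 0 e \<times> cbox 0 1) (\<lambda>(s, t). f (slide p i t (q + s *s axis j 1)) * (q $ i + s * \<delta> - p $ i))"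
      have "continuous_on (cbox 0 1) (\<lambda>t. case (s, t) of (s, t) \<Rightarrow>
          f (slide p i t (q + s *s axis j 1)) * (q $ i + s * \<delta> - p $ i))"
        by (rule continuous_on_compose2[OF cont]) (use that in \<open>auto intro!: continuous_intros\<close>)
      then show ?thesis by simp
    qed
    then show "(\<lambda>t. f (slide p i t (q + s *s axis j 1)) * (q $ i + s * \<delta> - p $ i)) integrable_on cbox 0 1"
      if "s \<in> ball 0 e" for s
      using that by (intro integrable_continuous)
  next
    show "continuous_on (ball 0 e \<times> cbox 0 1) (\<lambda>(s, t). h s t)"
      using cont_slide[OF f(2)] cont_slide[OF f(3)] unfolding h_def c_def
      by (cases "j = i") (auto intro!: continuous_intros simp: case_prod_unfold)
  qed (use e in auto)
  then have "((\<lambda>s. antideriv p i f (q + s *s axis j 1)) has_field_derivative integral {0..1} (h 0)) (at 0)"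
    using e by (simp add: antideriv_def at_within_open[of 0 "ball 0 e"] \<delta>_def axis_def algebra_simps
        if_distrib[of "(*) _"] eq_commute[of j])
  then show ?thesis by (simp add: has_partial_def h_def[abs_def] c_def \<delta>_def)
qed

lemma has_partial_antideriv_other:
  assumes "coord_star p S" "q \<in> S" "j \<noteq> i"
    and "\<And>q. q \<in> S \<Longrightarrow> has_partial j f (f' q) q" "continuous_on S f" "continuous_on S f'"
  shows "has_partial j (antideriv p i f) (antideriv p i f' q) q"
  using has_partial_antideriv[OF assms(1,2,4-6), of i] assms(3) by (simp add: antideriv_def)

text \<open>
  For \<open>j = i\<close> the integrand is the derivative of \<open>t f (slide p i t q)\<close> with respect to \<open>t\<close>.
\<close>

lemma has_partial_antideriv_same:
  assumes S: "coord_star p S" "q \<in> S"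
    and f: "\<And>q. q \<in> S \<Longrightarrow> has_partial i f (f' q) q" "continuous_on S f" "continuous_on S f'"
  shows "has_partial i (antideriv p i f) (f q) q"
proof -
  have "((\<lambda>t. of_real t * f (slide p i t q)) has_vector_derivative
      f' (slide p i t q) * of_real t * (q $ i - p $ i) + f (slide p i t q)) (at t within {0..1})"
    if "t \<in> {0..1}" for t
  proof -
    have "((\<lambda>t. f (slide p i t q)) has_vector_derivative f' (slide p i t q) * (q $ i - p $ i)) (at t within {0..1})"
      using S that by (intro slide_has_vector_derivative f) (auto simp: coord_star_def)
    moreover have "(of_real has_vector_derivative (1::'a)) (at t within {0..1})"
      by (auto intro!: derivative_eq_intros simp: has_vector_derivative_def scaleR_conv_of_real)
    ultimately have "((\<lambda>t. of_real t * f (slide p i t q)) has_vector_derivative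
        of_real t * (f' (slide p i t q) * (q $ i - p $ i)) + 1 * f (slide p i t q)) (at t within {0..1})"
      by (intro has_vector_derivative_mult)
    then show ?thesis by (simp add: mult.commute mult.left_commute)
  qed
  then have "((\<lambda>t. f' (slide p i t q) * of_real t * (q $ i - p $ i) + f (slide p i t q)) has_integral
      of_real 1 * f (slide p i 1 q) - of_real 0 * f (slide p i 0 q)) {0..1}"
    by (intro fundamental_theorem_of_calculus) auto
  then have "integral {0..1} (\<lambda>t. f' (slide p i t q) * of_real t * (q $ i - p $ i) + f (slide p i t q)) = f q"
    by (simp add: integral_unique)
  then show ?thesis using has_partial_antideriv[OF assms, of i] by simp
qed

lemma smooth_has_partial_antideriv:
  assumes "coord_star p S" "q \<in> S" "smooth_on S f"
  shows "has_partial j (antideriv p i f) (if j = i then f q else antideriv p i (partial_deriv j f) q) q"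
proof (cases "j = i")
  case True
  have "has_partial i (antideriv p i f) (f q) q"
    using assms by (intro has_partial_antideriv_same[where f'="partial_deriv i f"]
        smooth_on_has_partial[of S] smooth_on_continuous smooth_on_partial)
  then show ?thesis using True by simp
next
  case False
  have "has_partial j (antideriv p i f) (antideriv p i (partial_deriv j f) q) q"
    using assms by (intro has_partial_antideriv_other[OF _ _ False, of p S]
        smooth_on_has_partial[of S] smooth_on_continuous smooth_on_partial)
  then show ?thesis using False by simp
qed

text \<open>
  Each first partial derivative of \<open>antideriv p i f\<close> is either \<open>f\<close> or the antiderivative of a partial
  derivative of \<open>f\<close>, so the order of differentiability can be raised by induction.
\<close>

lemma smooth_on_antideriv:
  assumes "coord_star p S" "smooth_on S f"
  shows "smooth_on S (antideriv p i f)"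
proof -
  have S: "open S" using assms by (simp add: coord_star_def)
  have "Ck_on k S (antideriv p i f)" if "smooth_on S f" for k and f :: "'a ^ 'b \<Rightarrow> 'a"
    using that
  proof (induction k arbitrary: f)
    case 0
    then show ?case by (simp add: continuous_antideriv[OF assms(1)] smooth_on_continuous)
  next
    case (Suc k)
    show ?case
    proof (rule Ck_on_SucI[OF S, where f'="\<lambda>j q. if j = i then f q else antideriv p i (partial_deriv j f) q"])
      show "continuous_on S (antideriv p i f)"
        by (rule continuous_antideriv[OF assms(1) smooth_on_continuous[OF Suc.prems]])
      show "has_partial j (antideriv p i f) (if j = i then f q else antideriv p i (partial_deriv j f) q) q"
        if "q \<in> S" for j q
        by (rule smooth_has_partial_antideriv[OF assms(1) that Suc.prems])
      show "Ck_on k S (\<lambda>q. if j = i then f q else antideriv p i (partial_deriv j f) q)" for j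
        using Suc.prems Suc.IH[OF smooth_on_partial[OF Suc.prems]]
        by (cases "j = i") (simp_all add: smooth_on_def)
    qed
  qed
  then show ?thesis using assms(2) by (simp add: smooth_on_def)
qed

section \<open>Symmetry of second derivatives\<close>

lemma has_partial_slide0:
  assumes "has_partial j f d (slide p i 0 q)"
  shows "has_partial j (\<lambda>q. f (slide p i 0 q)) (if j = i then 0 else d) q"
  using assms by (simp add: has_partial_def slide_axis)

lemma smooth_on_slide0:
  assumes "coord_star p S" "smooth_on S f"
  shows "smooth_on S (\<lambda>q. f (slide p i 0 q))"
proof -
  have S: "open S" using assms by (simp add: coord_star_def)
  have sl: "slide p i 0 q \<in> S" if "q \<in> S" for q using assms(1) that by (simp add: coord_star_def)
  have "Ck_on k S (\<lambda>q. f (slide p i 0 q))" if "smooth_on S f" for k and f :: "'a ^ 'b \<Rightarrow> 'a"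
    using that
  proof (induction k arbitrary: f)
    case 0
    have "continuous_on S (\<lambda>q. slide p i 0 q)"
    proof -
      have "continuous_on S (\<lambda>q. case (q, 0) of (q, t) \<Rightarrow> slide p i t q)"
        by (rule continuous_on_compose2[OF continuous_slide]) (auto intro!: continuous_intros)
      then show ?thesis by simp
    qed
    then have "continuous_on S (\<lambda>q. f (slide p i 0 q))"
      by (rule continuous_on_compose2[OF smooth_on_continuous[OF 0]]) (use sl in auto)
    then show ?case by simp
  next
    case (Suc k)
    show ?case
    proof (rule Ck_on_SucI[OF S, where f'="\<lambda>j q. if j = i then 0 else partial_deriv j f (slide p i 0 q)"])
      show "continuous_on S (\<lambda>q. f (slide p i 0 q))"
        using Suc.IH[OF Suc.prems] Ck_on_continuous by blast
      show "has_partial j (\<lambda>q. f (slide p i 0 q)) (if j = i then 0 else partial_deriv j f (slide p i 0 q)) q"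
        if "q \<in> S" for j q
        by (rule has_partial_slide0) (rule smooth_on_has_partial[OF Suc.prems sl[OF that]])
      show "Ck_on k S (\<lambda>q. if j = i then 0 else partial_deriv j f (slide p i 0 q))" for j
        by (cases "j = i") (simp_all add: Ck_on_const S Suc.IH smooth_on_partial Suc.prems)
    qed
  qed
  then show ?thesis using assms(2) by (simp add: smooth_on_def)
qed

text \<open>
  Write \<open>f\<close> as the antiderivative of its \<open>i\<close>-th partial derivative plus its restriction to the slice
  through \<open>p\<close>. Differentiation in direction \<open>j\<close> passes under the integral, and a further
  differentiation in direction \<open>i\<close> undoes the integral and kills the term from the slice. This proves
  the symmetry over the real and the complex numbers without a Frechet derivative.
\<close>

lemma partial_deriv_commute:
  fixes f :: "'k::{real_normed_field, euclidean_space} ^ 'n::finite \<Rightarrow> 'k"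
  assumes "open U" "smooth_on U f" "p \<in> U"
  shows "partial_deriv i (partial_deriv j f) p = partial_deriv j (partial_deriv i f) p"
proof (cases "i = j")
  case False
  obtain S where S: "coord_star p S" "S \<subseteq> U" using coord_star_exists assms by metis
  have open_S: "open S" and p: "p \<in> S" using S by (auto simp: coord_star_def)
  have sl: "slide p i 0 q \<in> S" if "q \<in> S" for q using S(1) that by (simp add: coord_star_def)
  have f: "smooth_on S f" using assms S smooth_on_subset by blast
  note sm = smooth_on_partial[OF f] smooth_on_partial[OF smooth_on_partial[OF f]]
  have "partial_deriv j f q = antideriv p i (partial_deriv j (partial_deriv i f)) q
      + partial_deriv j f (slide p i 0 q)" if "q \<in> S" for q
  proof -
    have "has_partial j (\<lambda>q. antideriv p i (partial_deriv i f) q + f (slide p i 0 q))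
       (antideriv p i (partial_deriv j (partial_deriv i f)) q + partial_deriv j f (slide p i 0 q)) q"
      using False has_partial_slide0[OF smooth_on_has_partial[OF f sl[OF that]], of j]
        smooth_has_partial_antideriv[OF S(1) that sm(1)[of i], of j i]
      by (intro has_partial_add) auto
    then have "has_partial j f
       (antideriv p i (partial_deriv j (partial_deriv i f)) q + partial_deriv j f (slide p i 0 q)) q"
      using has_partial_cong_open[OF open_S that, of "\<lambda>q. antideriv p i (partial_deriv i f) q + f (slide p i 0 q)" f j]
        antideriv_partial[OF S(1) _ smooth_on_has_partial[OF f]] by simp
    then show ?thesis by (rule partial_deriv_eq)
  qed
  then have "partial_deriv i (partial_deriv j f) p =
      partial_deriv i (\<lambda>q. antideriv p i (partial_deriv j (partial_deriv i f)) q
      + partial_deriv j f (slide p i 0 q)) p"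
    by (intro partial_deriv_cong_open[OF open_S p])
  also have "\<dots> = partial_deriv j (partial_deriv i f) p + 0"
  proof (intro partial_deriv_eq has_partial_add)
    show "has_partial i (\<lambda>q. partial_deriv j f (slide p i 0 q)) 0 p"
    proof -
      have "has_partial i (\<lambda>q. partial_deriv j f (slide p i 0 q))
          (if i = i then 0 else partial_deriv i (partial_deriv j f) (slide p i 0 p)) p"
        by (rule has_partial_slide0[OF smooth_on_has_partial[OF sm(1) sl[OF p]]])
      then show ?thesis by simp
    qed
    show "has_partial i (antideriv p i (partial_deriv j (partial_deriv i f))) (partial_deriv j (partial_deriv i f) p) p"
    proof -
      have "has_partial i (antideriv p i (partial_deriv j (partial_deriv i f)))
          (if i = i then partial_deriv j (partial_deriv i f) p
           else antideriv p i (partial_deriv i (partial_deriv j (partial_deriv i f))) p) p"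
        by (rule smooth_has_partial_antideriv[OF S(1) p sm(2)])
      then show ?thesis by simp
    qed
  qed
  finally show ?thesis by simp
qed simp

section \<open>Closed two-forms in three dimensions are locally exact\<close>

text \<open>
  The potential is sought in the gauge \<open>\<alpha>\<^sub>1 = 0\<close>. Then \<open>\<alpha>\<^sub>2\<close> and \<open>\<alpha>\<^sub>3\<close> are antiderivatives of \<open>A\<close> and \<open>B\<close>
  in the first coordinate, up to functions of the other two coordinates; one such function, added
  to \<open>\<alpha>\<^sub>3\<close>, adjusts the component \<open>C\<close> on the slice through \<open>p\<close>, and closedness propagates the equation
  off the slice.
\<close>

lemma poincare_two_form_3:
  fixes A B C :: "'k::{real_normed_field, euclidean_space} ^ 3 \<Rightarrow> 'k"
  assumes "open U" "p \<in> U" "smooth_on U A" "smooth_on U B" "smooth_on U C"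
    and closed: "\<And>q. q \<in> U \<Longrightarrow> partial_deriv 1 C q - partial_deriv 2 B q + partial_deriv 3 A q = 0"
  obtains W \<alpha> where "open W" "p \<in> W" "W \<subseteq> U" "smooth_one_form_on W \<alpha>"
    "\<And>q. q \<in> W \<Longrightarrow> ext_deriv1 \<alpha> q $ 1 $ 2 = A q"
    "\<And>q. q \<in> W \<Longrightarrow> ext_deriv1 \<alpha> q $ 1 $ 3 = B q"
    "\<And>q. q \<in> W \<Longrightarrow> ext_deriv1 \<alpha> q $ 2 $ 3 = C q"
proof -
  obtain S where S: "coord_star p S" "S \<subseteq> U" using coord_star_exists assms by metis
  have open_S: "open S" and p: "p \<in> S" using S by (auto simp: coord_star_def)
  have sl: "slide p i 0 q \<in> S" if "q \<in> S" for q i using S(1) that by (simp add: coord_star_def)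
  have sm: "smooth_on S A" "smooth_on S B" "smooth_on S C"
    using assms S smooth_on_subset by blast+
  note sm' = sm[THEN smooth_on_partial]
  define C0 where "C0 = (\<lambda>q. C (slide p 1 0 q))"
  have C0: "smooth_on S C0" unfolding C0_def by (rule smooth_on_slide0[OF S(1) sm(3)])
  define a2 where "a2 = antideriv p 1 A"
  define a3 where "a3 = (\<lambda>q. antideriv p 1 B q + antideriv p 2 C0 q)"
  define \<alpha> :: "'k ^ 3 \<Rightarrow> 'k ^ 3" where "\<alpha> q = vector [0, a2 q, a3 q]" for q
  have \<alpha>_simps [simp]: "(\<lambda>q. \<alpha> q $ 1) = (\<lambda>q. 0)" "(\<lambda>q. \<alpha> q $ 2) = a2" "(\<lambda>q. \<alpha> q $ 3) = a3"
    by (auto simp: \<alpha>_def)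
  have "smooth_on S (\<lambda>q. \<alpha> q $ i)" for i
    using exhaust_3[of i] unfolding a2_def a3_def
    by (auto simp: a2_def a3_def intro!: smooth_on_const open_S smooth_on_add smooth_on_antideriv[OF S(1)] sm C0)
  then have 1: "smooth_one_form_on S \<alpha>" by (simp add: smooth_one_form_on_def)
  have z: "partial_deriv i (\<lambda>q. 0) q = (0::'k)" for i q
    by (rule partial_deriv_eq) (rule has_partial_const)
  have a2_1: "partial_deriv 1 a2 q = A q" if "q \<in> S" for q
    using smooth_has_partial_antideriv[OF S(1) that sm(1), of 1 1]
    unfolding a2_def by (auto intro: partial_deriv_eq)
  have a2_3: "partial_deriv 3 a2 q = antideriv p 1 (partial_deriv 3 A) q" if "q \<in> S" for q
    using smooth_has_partial_antideriv[OF S(1) that sm(1), of 3 1]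
    unfolding a2_def by (auto intro: partial_deriv_eq)
  have C0_1: "partial_deriv 1 C0 q = 0" if "q \<in> S" for q
    using has_partial_slide0[OF smooth_on_has_partial[OF sm(3) sl[OF that]], of 1 1]
    unfolding C0_def by (auto intro: partial_deriv_eq)
  have C0_0: "antideriv p 2 (partial_deriv 1 C0) q = 0" if "q \<in> S" for q
  proof -
    have "antideriv p 2 (partial_deriv 1 C0) q = integral {0..1} (\<lambda>t::real. 0)"
      unfolding antideriv_def
      by (rule Henstock_Kurzweil_Integration.integral_cong) (use S(1) that in \<open>auto simp: coord_star_def C0_1\<close>)
    then show ?thesis by simp
  qed
  have a3_1: "partial_deriv 1 a3 q = B q" if "q \<in> S" for q
  proof -
    have "has_partial 1 a3 (B q + antideriv p 2 (partial_deriv 1 C0) q) q" 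
      using has_partial_add[OF smooth_has_partial_antideriv[OF S(1) that sm(2), of 1 1]
          smooth_has_partial_antideriv[OF S(1) that C0, of 1 2]]
      unfolding a3_def by simp
    then show ?thesis using C0_0[OF that] by (simp add: partial_deriv_eq)
  qed
  have a3_2: "partial_deriv 2 a3 q = antideriv p 1 (partial_deriv 2 B) q + C0 q" if "q \<in> S" for q
    using has_partial_add[OF smooth_has_partial_antideriv[OF S(1) that sm(2), of 2 1]
          smooth_has_partial_antideriv[OF S(1) that C0, of 2 2]]
    unfolding a3_def by (auto intro: partial_deriv_eq)
  have "C q = partial_deriv 2 a3 q - partial_deriv 3 a2 q" if "q \<in> S" for q
  proof -
    have int: "(\<lambda>t. f (slide p 1 t q) * (q $ 1 - p $ 1)) integrable_on {0..1}"
      if "smooth_on S f" for f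
    proof -
      have "continuous_on {0..1} (\<lambda>t. f (slide p 1 t q))"
      proof -
        have "continuous_on {0..1} (\<lambda>t. case (q, t) of (q, t) \<Rightarrow> f (slide p 1 t q))"
          by (rule continuous_on_compose2[OF continuous_on_slide_comp[OF S(1) smooth_on_continuous[OF that]]])
            (use \<open>q \<in> S\<close> in \<open>auto intro!: continuous_intros\<close>)
        then show ?thesis by simp
      qed
      then show ?thesis by (intro integrable_continuous_interval continuous_intros)
    qed
    have "C q - C0 q = antideriv p 1 (partial_deriv 1 C) q"
      unfolding C0_def using antideriv_partial[OF S(1) that smooth_on_has_partial[OF sm(3)]] by simp
    also have "\<dots> = antideriv p 1 (\<lambda>q. partial_deriv 2 B q - partial_deriv 3 A q) q"
      unfolding antideriv_def
    proof (rule Henstock_Kurzweil_Integration.integral_cong)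
      fix t :: real assume "t \<in> {0..1}"
      then have "slide p 1 t q \<in> U" using S that by (auto simp: coord_star_def)
      from closed[OF this] show "partial_deriv 1 C (slide p 1 t q) * (q $ 1 - p $ 1) =
          (partial_deriv 2 B (slide p 1 t q) - partial_deriv 3 A (slide p 1 t q)) * (q $ 1 - p $ 1)"
        by algebra
    qed
    also have "\<dots> = antideriv p 1 (partial_deriv 2 B) q - antideriv p 1 (partial_deriv 3 A) q"
      unfolding antideriv_def
      using integral_diff[OF int int, OF sm'(2)[of 2] sm'(1)[of 3]] by (simp add: algebra_simps)
    finally show ?thesis using a2_3[OF that] a3_2[OF that] by (simp add: algebra_simps)
  qed
  then show ?thesis
    using that[OF open_S p S(2) 1] by (simp add: ext_deriv1_def z a2_1 a3_1)
qed

section \<open>Matrix-valued functions\<close>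

lemma matrix_diff_ldistrib: "A ** (B - C) = A ** B - A ** (C :: 'a::ring_1 ^ 'n ^ 'm)"
  by (simp add: matrix_matrix_mult_def vec_eq_iff right_diff_distrib sum_subtractf)

lemma matrix_diff_rdistrib: "(B - C) ** A = B ** A - C ** (A :: 'a::ring_1 ^ 'n ^ 'm)"
  by (simp add: matrix_matrix_mult_def vec_eq_iff left_diff_distrib sum_subtractf)

lemma matrix_add_rdistrib: "(B + C) ** A = B ** A + C ** (A :: 'a::ring_1 ^ 'n ^ 'm)"
  by (simp add: matrix_matrix_mult_def vec_eq_iff distrib_right sum.distrib)

lemma matrix_minus_right: "A ** (- B) = - (A ** (B :: 'a::ring_1 ^ 'n ^ 'm))"
  by (simp add: matrix_matrix_mult_def vec_eq_iff sum_negf)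

lemma matrix_zero: "A ** 0 = 0" "0 ** A = (0 :: 'a::semiring_1 ^ 'n ^ 'm)"
  by (simp_all add: matrix_matrix_mult_def vec_eq_iff)

lemma matrix_minus_left: "(- B) ** A = - (B ** (A :: 'a::ring_1 ^ 'n ^ 'm))"
  by (simp add: matrix_matrix_mult_def vec_eq_iff sum_negf)

lemma transpose_plus: "transpose (A + B) = transpose A + transpose B"
  by (simp add: transpose_def vec_eq_iff)

lemma matrix_inv_eq:
  assumes "A ** B = mat 1" "B ** A = mat 1"
  shows "matrix_inv A = (B :: 'a::semiring_1 ^ 'n ^ 'n)"
proof -
  have "A ** matrix_inv A = mat 1 \<and> matrix_inv A ** A = mat 1"
    unfolding matrix_inv_def using assms by (intro someI_ex[of "\<lambda>A'. A ** A' = mat 1 \<and> A' ** A = mat 1"]) blast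
  then have "matrix_inv A = (B ** A) ** matrix_inv A" using assms by simp
  also have "\<dots> = B" using \<open>_ \<and> _\<close> by (simp add: matrix_mul_assoc[symmetric])
  finally show ?thesis .
qed

definition has_partial_mat ::
  "'n::finite \<Rightarrow> ('k::real_normed_field ^ 'n \<Rightarrow> 'k ^ 'b ^ 'a) \<Rightarrow> 'k ^ 'b ^ 'a \<Rightarrow> 'k ^ 'n \<Rightarrow> bool" where
  "has_partial_mat i A D p \<longleftrightarrow> (\<forall>a b. has_partial i (\<lambda>q. A q $ a $ b) (D $ a $ b) p)"

definition partial_mat ::
  "'n::finite \<Rightarrow> ('k::real_normed_field ^ 'n \<Rightarrow> 'k ^ 'b ^ 'a) \<Rightarrow> 'k ^ 'n \<Rightarrow> 'k ^ 'b ^ 'a" where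
  "partial_mat i A p = (\<chi> a b. partial_deriv i (\<lambda>q. A q $ a $ b) p)"

definition smooth_mat ::
  "('k::real_normed_field ^ 'n::finite) set \<Rightarrow> ('k ^ 'n \<Rightarrow> 'k ^ 'b ^ 'a) \<Rightarrow> bool" where
  "smooth_mat S A \<longleftrightarrow> (\<forall>a b. smooth_on S (\<lambda>p. A p $ a $ b))"

lemma partial_mat_eq: "has_partial_mat i A D p \<Longrightarrow> partial_mat i A p = D"
  by (simp add: has_partial_mat_def partial_mat_def vec_eq_iff partial_deriv_eq)

lemma smooth_mat_has_partial:
  "smooth_mat S A \<Longrightarrow> p \<in> S \<Longrightarrow> has_partial_mat i A (partial_mat i A p) p"
  unfolding has_partial_mat_def partial_mat_def smooth_mat_def
  by (simp, blast intro: smooth_on_has_partial)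

lemma smooth_mat_partial: "smooth_mat S A \<Longrightarrow> smooth_mat S (partial_mat i A)"
  by (simp add: partial_mat_def smooth_mat_def smooth_on_partial)

lemma partial_mat_commute:
  fixes A :: "'k::{real_normed_field, euclidean_space} ^ 'n::finite \<Rightarrow> 'k ^ 'b ^ 'a"
  assumes "open S" "smooth_mat S A" "p \<in> S"
  shows "partial_mat i (partial_mat j A) p = partial_mat j (partial_mat i A) p"
  using assms by (simp add: partial_mat_def smooth_mat_def vec_eq_iff partial_deriv_commute[of S])

lemma has_partial_mat_const: "has_partial_mat i (\<lambda>q. A) 0 p"
  by (simp add: has_partial_mat_def has_partial_const)

lemma has_partial_mat_add:
  "has_partial_mat i A A' p \<Longrightarrow> has_partial_mat i B B' p \<Longrightarrow>
   has_partial_mat i (\<lambda>q. A q + B q) (A' + B') p"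
  by (simp add: has_partial_mat_def has_partial_add)

lemma has_partial_mat_transpose:
  "has_partial_mat i A A' p \<Longrightarrow> has_partial_mat i (\<lambda>q. transpose (A q)) (transpose A') p"
  by (simp add: has_partial_mat_def transpose_def)

lemma has_partial_mat_mult:
  assumes "has_partial_mat i A A' p" "has_partial_mat i B B' p"
  shows "has_partial_mat i (\<lambda>q. A q ** B q) (A' ** B p + A p ** B') p"
  unfolding has_partial_mat_def
proof (intro allI)
  fix a b
  have "has_partial i (\<lambda>q. \<Sum>k\<in>UNIV. A q $ a $ k * B q $ k $ b)
      (\<Sum>k\<in>UNIV. A' $ a $ k * B p $ k $ b + A p $ a $ k * B' $ k $ b) p"
    using assms by (intro has_partial_sum has_partial_mult) (auto simp: has_partial_mat_def)
  then show "has_partial i (\<lambda>q. (A q ** B q) $ a $ b) ((A' ** B p + A p ** B') $ a $ b) p"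
    by (simp add: matrix_matrix_mult_def sum.distrib)
qed

lemma has_partial_mat_cong_open:
  assumes "open S" "p \<in> S" "\<And>q. q \<in> S \<Longrightarrow> A q = B q"
  shows "has_partial_mat i A D p \<longleftrightarrow> has_partial_mat i B D p"
proof -
  have "has_partial i (\<lambda>q. A q $ a $ b) d p \<longleftrightarrow> has_partial i (\<lambda>q. B q $ a $ b) d p" for a b d
    by (rule has_partial_cong_open[OF assms(1,2)]) (simp add: assms(3))
  then show ?thesis by (simp add: has_partial_mat_def)
qed

lemma smooth_mat_mult:
  "open S \<Longrightarrow> smooth_mat S A \<Longrightarrow> smooth_mat S B \<Longrightarrow> smooth_mat S (\<lambda>p. A p ** B p)"
  by (simp add: smooth_mat_def matrix_matrix_mult_def smooth_on_sum smooth_on_mult)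

lemma smooth_mat_transpose: "smooth_mat S A \<Longrightarrow> smooth_mat S (\<lambda>p. transpose (A p))"
  by (simp add: smooth_mat_def transpose_def)

lemma smooth_mat_const: "open S \<Longrightarrow> smooth_mat S (\<lambda>p. A)"
  by (simp add: smooth_mat_def smooth_on_const)

section \<open>The Levi-Civita connection in a moving frame\<close>

text \<open>
  The uniqueness half of the fundamental theorem of Riemannian geometry. It is used to avoid ever
  expanding the Christoffel symbols from their definition: a connection that is found by other
  means only has to be checked to be metric and symmetric.
\<close>

lemma christoffel_unique:
  fixes g :: "'k::real_normed_field metric4" and \<Gamma> :: "4 \<Rightarrow> 'k ^ 4 ^ 4"
  assumes metric: "\<And>k. partial_mat k g p = transpose (\<Gamma> k) ** g p + g p ** \<Gamma> k"
    and torsion: "\<And>i j l. \<Gamma> i $ l $ j = \<Gamma> j $ l $ i"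
    and sym: "transpose (g p) = g p"
    and inv: "matrix_inv (g p) ** g p = mat 1"
  shows "christoffel g l i j p = \<Gamma> i $ l $ j"
proof -
  have g: "g p $ i $ j = g p $ j $ i" for i j
    using arg_cong[OF sym, of "\<lambda>M. M $ j $ i"] by (simp add: transpose_def)
  have d: "partial_deriv k (\<lambda>q. g q $ i $ j) p
      = (\<Sum>m\<in>UNIV. \<Gamma> k $ m $ i * g p $ m $ j + g p $ i $ m * \<Gamma> k $ m $ j)" for i j k
    using arg_cong[OF metric[of k], of "\<lambda>M. M $ i $ j"]
    by (simp add: partial_mat_def matrix_matrix_mult_def transpose_def sum.distrib)
  have "partial_deriv i (\<lambda>q. g q $ j $ m) p + partial_deriv j (\<lambda>q. g q $ i $ m) p
         - partial_deriv m (\<lambda>q. g q $ i $ j) p = (\<Sum>n\<in>UNIV. 2 * (\<Gamma> i $ n $ j * g p $ m $ n))" for m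
    unfolding d sum.distrib[symmetric] sum_subtractf[symmetric]
  proof (rule sum.cong)
    fix n
    show "\<Gamma> i $ n $ j * g p $ n $ m + g p $ j $ n * \<Gamma> i $ n $ m
        + (\<Gamma> j $ n $ i * g p $ n $ m + g p $ i $ n * \<Gamma> j $ n $ m)
        - (\<Gamma> m $ n $ i * g p $ n $ j + g p $ i $ n * \<Gamma> m $ n $ j) = 2 * (\<Gamma> i $ n $ j * g p $ m $ n)"
      unfolding g[of n m] g[of n j] torsion[of j n i] torsion[of m n i] torsion[of m n j]
      by (simp add: algebra_simps)
  qed simp
  then have "christoffel g l i j p = (\<Sum>m\<in>UNIV. matrix_inv (g p) $ l $ m * (\<Sum>n\<in>UNIV. 2 * (\<Gamma> i $ n $ j * g p $ m $ n))) / 2"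
    by (simp add: christoffel_def)
  also have "\<dots> = (\<Sum>m\<in>UNIV. \<Sum>n\<in>UNIV. matrix_inv (g p) $ l $ m * g p $ m $ n * \<Gamma> i $ n $ j)"
    by (simp add: sum_distrib_left sum_distrib_right sum_divide_distrib algebra_simps)
  also have "\<dots> = (\<Sum>n\<in>UNIV. (\<Sum>m\<in>UNIV. matrix_inv (g p) $ l $ m * g p $ m $ n) * \<Gamma> i $ n $ j)"
    by (subst sum.swap) (simp add: sum_distrib_right)
  also have "\<dots> = ((matrix_inv (g p) ** g p) ** \<Gamma> i) $ l $ j"
    by (simp add: matrix_matrix_mult_def)
  finally show ?thesis by (simp add: inv)
qed

text \<open>
  The rows of \<open>\<Theta>\<close> form a coframe, the columns of \<open>E\<close> the dual frame, and \<open>\<omega> i\<close> is the \<open>i\<close>-th coordinate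
  component of the matrix of connection one-forms. The assumption \<open>torsion_free\<close> is Cartan's first
  structure equation, written as symmetry in \<open>i\<close> and \<open>j\<close>. That the constant matrix \<open>H\<close> of inner products
  is its own inverse holds for orthonormal and for normalised null frames.
\<close>

locale moving_frame =
  fixes S :: "('k::{real_normed_field, euclidean_space} ^ 4) set"
    and \<Theta> E :: "'k ^ 4 \<Rightarrow> 'k ^ 4 ^ 4" and H :: "'k ^ 4 ^ 4"
    and \<omega> :: "4 \<Rightarrow> 'k ^ 4 \<Rightarrow> 'k ^ 4 ^ 4" and g :: "'k metric4"
  assumes open_S: "open S"
    and smooth_coframe: "smooth_mat S \<Theta>" and smooth_frame: "smooth_mat S E"
    and smooth_connection: "\<And>i. smooth_mat S (\<omega> i)"
    and frame_coframe: "\<And>p. p \<in> S \<Longrightarrow> E p ** \<Theta> p = mat 1"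
    and H_sym: "transpose H = H" and H_involution: "H ** H = mat 1"
    and skew: "\<And>i p. p \<in> S \<Longrightarrow> transpose (\<omega> i p) ** H = - (H ** \<omega> i p)"
    and torsion_free: "\<And>i j a p. p \<in> S \<Longrightarrow>
      (partial_mat i \<Theta> p + \<omega> i p ** \<Theta> p) $ a $ j = (partial_mat j \<Theta> p + \<omega> j p ** \<Theta> p) $ a $ i"
    and metric_eq: "\<And>p. p \<in> S \<Longrightarrow> g p = transpose (\<Theta> p) ** H ** \<Theta> p"
begin

lemma coframe_frame: "p \<in> S \<Longrightarrow> \<Theta> p ** E p = mat 1"
  using frame_coframe matrix_left_right_inverse by blast

lemma coframe_frame_cancel: "p \<in> S \<Longrightarrow> A ** \<Theta> p ** E p = A"
  "p \<in> S \<Longrightarrow> A ** E p ** \<Theta> p = A"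
  by (simp_all add: coframe_frame frame_coframe matrix_mul_assoc[symmetric])

lemma transpose_coframe_frame:
  "p \<in> S \<Longrightarrow> transpose (E p) ** transpose (\<Theta> p) = mat 1"
  "p \<in> S \<Longrightarrow> transpose (\<Theta> p) ** transpose (E p) = mat 1"
  by (simp_all add: coframe_frame frame_coframe matrix_transpose_mul[symmetric])

lemma metric_sym: "p \<in> S \<Longrightarrow> transpose (g p) = g p"
  by (simp add: metric_eq matrix_transpose_mul H_sym matrix_mul_assoc)

lemma metric_inv_right: "p \<in> S \<Longrightarrow> g p ** (E p ** H ** transpose (E p)) = mat 1"
proof -
  assume p: "p \<in> S"
  have "transpose (\<Theta> p) ** H ** \<Theta> p ** (E p ** H ** transpose (E p))
      = transpose (\<Theta> p) ** (H ** (\<Theta> p ** E p) ** H) ** transpose (E p)"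
    by (simp add: matrix_mul_assoc)
  then show ?thesis
    using p by (simp add: metric_eq coframe_frame H_involution transpose_coframe_frame)
qed

lemma metric_inv_left: "p \<in> S \<Longrightarrow> E p ** H ** transpose (E p) ** g p = mat 1"
  using metric_inv_right matrix_left_right_inverse by blast

lemma metric_inv: "p \<in> S \<Longrightarrow> matrix_inv (g p) = E p ** H ** transpose (E p)"
  by (intro matrix_inv_eq metric_inv_right metric_inv_left)

lemma frame_metric: "p \<in> S \<Longrightarrow> transpose (E p) ** g p ** E p = H"
  by (simp add: metric_eq matrix_mul_assoc transpose_coframe_frame coframe_frame_cancel)

text \<open>
  The gauge transform of \<open>\<omega>\<close> from the frame to coordinates; the first index of the matrix is the upper
  index of the Christoffel symbol.
\<close>

definition conn :: "4 \<Rightarrow> 'k ^ 4 \<Rightarrow> 'k ^ 4 ^ 4" where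
  "conn i p = E p ** (partial_mat i \<Theta> p + \<omega> i p ** \<Theta> p)"

definition curv :: "4 \<Rightarrow> 4 \<Rightarrow> 'k ^ 4 \<Rightarrow> 'k ^ 4 ^ 4" where
  "curv i j p = partial_mat i (\<omega> j) p - partial_mat j (\<omega> i) p + (\<omega> i p ** \<omega> j p - \<omega> j p ** \<omega> i p)"

lemma partial_metric:
  assumes p: "p \<in> S"
  shows "partial_mat k g p = transpose (partial_mat k \<Theta> p) ** H ** \<Theta> p + transpose (\<Theta> p) ** H ** partial_mat k \<Theta> p"
proof -
  note d = smooth_mat_has_partial[OF smooth_coframe p, of k]
  have "has_partial_mat k (\<lambda>q. transpose (\<Theta> q) ** H ** \<Theta> q)
     ((transpose (partial_mat k \<Theta> p) ** H + transpose (\<Theta> p) ** 0) ** \<Theta> p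
       + (transpose (\<Theta> p) ** H) ** partial_mat k \<Theta> p) p"
    by (intro has_partial_mat_mult has_partial_mat_transpose has_partial_mat_const d)
  moreover have "has_partial_mat k (\<lambda>q. transpose (\<Theta> q) ** H ** \<Theta> q) D p \<longleftrightarrow> has_partial_mat k g D p" for D
    by (rule has_partial_mat_cong_open[OF open_S p]) (simp add: metric_eq)
  ultimately show ?thesis
    by (simp add: partial_mat_eq matrix_zero)
qed

lemma christoffel_eq:
  assumes p: "p \<in> S"
  shows "christoffel g l i j p = conn i p $ l $ j"
proof (rule christoffel_unique)
  fix k
  have "transpose (conn k p) ** g p + g p ** conn k p
      = transpose (partial_mat k \<Theta> p) ** H ** \<Theta> p + transpose (\<Theta> p) ** H ** partial_mat k \<Theta> p
        + transpose (\<Theta> p) ** (transpose (\<omega> k p) ** H + H ** \<omega> k p) ** \<Theta> p"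
  proof -
    have "transpose (conn k p) ** g p
       = (transpose (partial_mat k \<Theta> p) + transpose (\<Theta> p) ** transpose (\<omega> k p))
          ** (transpose (E p) ** transpose (\<Theta> p)) ** H ** \<Theta> p"
      by (simp add: conn_def metric_eq p matrix_transpose_mul transpose_plus matrix_mul_assoc)
    moreover have "g p ** conn k p = transpose (\<Theta> p) ** H ** (\<Theta> p ** E p) ** (partial_mat k \<Theta> p + \<omega> k p ** \<Theta> p)"
      by (simp add: conn_def metric_eq p matrix_mul_assoc)
    ultimately show ?thesis
      by (simp add: p coframe_frame transpose_coframe_frame matrix_add_ldistrib matrix_add_rdistrib
          matrix_mul_assoc add_ac)
  qed
  then show "partial_mat k g p = transpose (conn k p) ** g p + g p ** conn k p"
    by (simp add: partial_metric p skew)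
next
  fix i j l
  show "conn i p $ l $ j = conn j p $ l $ i"
    using torsion_free[OF p, of i _ j] by (simp add: conn_def matrix_matrix_mult_def[of "E p"])
next
  show "matrix_inv (g p) ** g p = mat 1"
    using metric_inv_left[OF p] by (simp add: metric_inv[OF p])
qed (rule metric_sym[OF p])

text \<open>
  Curvature is gauge covariant. The inhomogeneous terms of \<open>conn\<close> cancel because
  \<open>\<partial>\<^sub>i E = - E (\<partial>\<^sub>i \<Theta>) E\<close> and because second derivatives of \<open>\<Theta>\<close> commute.
\<close>

lemma riemann_up_eq:
  assumes p: "p \<in> S"
  shows "riemann_up g l k i j p = (E p ** curv i j p ** \<Theta> p) $ l $ k"
proof -
  define E' where "E' i = partial_mat i E p" for i
  define T where "T i = partial_mat i \<Theta> p" for i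
  define TT where "TT i j = partial_mat i (partial_mat j \<Theta>) p" for i j
  define W where "W i j = partial_mat i (\<omega> j) p" for i j
  have dE: "E' i = - (E p ** T i ** E p)" for i
  proof -
    have "has_partial_mat i (\<lambda>q. E q ** \<Theta> q) (E' i ** \<Theta> p + E p ** T i) p"
      unfolding E'_def T_def
      by (intro has_partial_mat_mult smooth_mat_has_partial[OF _ p] smooth_coframe smooth_frame)
    moreover have "has_partial_mat i (\<lambda>q. E q ** \<Theta> q) D p \<longleftrightarrow> has_partial_mat i (\<lambda>q. mat 1) D p" for D
      by (rule has_partial_mat_cong_open[OF open_S p]) (simp add: frame_coframe)
    ultimately have "has_partial_mat i (\<lambda>q. mat 1) (E' i ** \<Theta> p + E p ** T i) p" by simp
    then have "E' i ** \<Theta> p + E p ** T i = 0"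
      using partial_mat_eq[OF has_partial_mat_const] partial_mat_eq by metis
    then have "(E' i ** \<Theta> p + E p ** T i) ** E p = 0" by simp
    then have "E' i + E p ** T i ** E p = 0"
      by (simp add: matrix_add_rdistrib coframe_frame_cancel p)
    then show ?thesis by (simp add: eq_neg_iff_add_eq_0)
  qed
  define Q where "Q i j = TT i j + W i j ** \<Theta> p + \<omega> j p ** T i + \<omega> i p ** T j + \<omega> i p ** \<omega> j p ** \<Theta> p" for i j
  have dconn: "partial_mat i (conn j) p + conn i p ** conn j p = E p ** Q i j" for i j
  proof -
    have "has_partial_mat i (conn j) (E' i ** (partial_mat j \<Theta> p + \<omega> j p ** \<Theta> p)
        + E p ** (TT i j + (W i j ** \<Theta> p + \<omega> j p ** T i))) p"
      unfolding conn_def[abs_def] E'_def T_def TT_def W_def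
      by (intro has_partial_mat_mult has_partial_mat_add smooth_mat_has_partial[OF _ p] smooth_coframe
          smooth_frame smooth_mat_partial smooth_connection)
    then have "partial_mat i (conn j) p = E' i ** (T j + \<omega> j p ** \<Theta> p)
        + E p ** (TT i j + (W i j ** \<Theta> p + \<omega> j p ** T i))"
      by (simp add: partial_mat_eq T_def)
    then show ?thesis
      unfolding conn_def T_def[symmetric] Q_def dE
      by (simp add: matrix_add_ldistrib matrix_add_rdistrib matrix_mul_assoc coframe_frame_cancel p
          matrix_minus_left algebra_simps)
  qed
  have "TT i j = TT j i"
    unfolding TT_def by (rule partial_mat_commute[OF open_S smooth_coframe p])
  then have "Q i j - Q j i = curv i j p ** \<Theta> p"
    unfolding Q_def curv_def W_def
    by (simp add: matrix_add_rdistrib matrix_diff_rdistrib algebra_simps)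
  then have "partial_mat i (conn j) p - partial_mat j (conn i) p
      + (conn i p ** conn j p - conn j p ** conn i p) = E p ** curv i j p ** \<Theta> p"
    using dconn[of i j] dconn[of j i]
    by (simp add: matrix_diff_ldistrib[symmetric] matrix_mul_assoc[symmetric] algebra_simps)
  moreover have "partial_deriv i (christoffel g l j k) p = partial_deriv i (\<lambda>q. conn j q $ l $ k) p" for i j
    by (rule partial_deriv_cong_open[OF open_S p]) (rule christoffel_eq)
  ultimately show ?thesis
    unfolding riemann_up_def
    by (simp add: christoffel_eq[OF p] partial_mat_def matrix_matrix_mult_def sum_subtractf vec_eq_iff)
qed

lemma riemann_eq:
  assumes p: "p \<in> S"
  shows "riemann g l k i j p = (transpose (\<Theta> p) ** (H ** curv i j p) ** \<Theta> p) $ l $ k"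
proof -
  have "riemann g l k i j p = (g p ** (E p ** curv i j p ** \<Theta> p)) $ l $ k"
    by (simp add: riemann_def riemann_up_eq[OF p] matrix_matrix_mult_def[of "g p"])
  also have "g p ** (E p ** curv i j p ** \<Theta> p) = transpose (\<Theta> p) ** (H ** curv i j p) ** \<Theta> p"
    by (simp add: metric_eq p matrix_mul_assoc coframe_frame_cancel)
  finally show ?thesis .
qed

lemma curv_skew:
  assumes p: "p \<in> S"
  shows "transpose (H ** curv i j p) = - (H ** curv i j p)"
proof -
  have W: "transpose (partial_mat i (\<omega> j) p) ** H = - (H ** partial_mat i (\<omega> j) p)" for i j
  proof -
    note d = smooth_mat_has_partial[OF smooth_connection p, of i j]
    have "has_partial_mat i (\<lambda>q. transpose (\<omega> j q) ** H + H ** \<omega> j q)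
       ((transpose (partial_mat i (\<omega> j) p) ** H + transpose (\<omega> j p) ** 0)
        + (0 ** \<omega> j p + H ** partial_mat i (\<omega> j) p)) p"
      by (intro has_partial_mat_mult has_partial_mat_add has_partial_mat_transpose has_partial_mat_const d)
    moreover have "has_partial_mat i (\<lambda>q. transpose (\<omega> j q) ** H + H ** \<omega> j q) D p \<longleftrightarrow> has_partial_mat i (\<lambda>q. 0) D p" for D
      by (rule has_partial_mat_cong_open[OF open_S p]) (simp add: skew)
    ultimately have "has_partial_mat i (\<lambda>q. 0)
       ((transpose (partial_mat i (\<omega> j) p) ** H + transpose (\<omega> j p) ** 0)
        + (0 ** \<omega> j p + H ** partial_mat i (\<omega> j) p)) p" by simp
    from partial_mat_eq[OF this] partial_mat_eq[OF has_partial_mat_const, of i "0 :: 'k ^ 4 ^ 4" p]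
    have "transpose (partial_mat i (\<omega> j) p) ** H + H ** partial_mat i (\<omega> j) p = 0"
      by (simp add: matrix_zero)
    then show ?thesis by (simp add: eq_neg_iff_add_eq_0)
  qed
  have WW: "transpose (\<omega> i p ** \<omega> j p) ** H = H ** (\<omega> j p ** \<omega> i p)" for i j
  proof -
    have "transpose (\<omega> i p ** \<omega> j p) ** H = transpose (\<omega> j p) ** (transpose (\<omega> i p) ** H)"
      by (simp add: matrix_transpose_mul matrix_mul_assoc)
    also have "\<dots> = - ((transpose (\<omega> j p) ** H) ** \<omega> i p)"
      by (simp add: skew[OF p] matrix_mul_assoc matrix_minus_right)
    also have "\<dots> = H ** (\<omega> j p ** \<omega> i p)"
      by (simp add: skew[OF p] matrix_minus_left matrix_mul_assoc)
    finally show ?thesis .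
  qed
  have td: "transpose (A - B) = transpose A - transpose B" for A B :: "'k ^ 4 ^ 4"
    by (simp add: transpose_def vec_eq_iff)
  show ?thesis
    unfolding curv_def matrix_transpose_mul H_sym
    by (simp add: transpose_plus td matrix_add_ldistrib matrix_add_rdistrib matrix_diff_ldistrib
        matrix_diff_rdistrib W WW algebra_simps)
qed

end

section \<open>Contraction of tensors with vectors\<close>

text \<open>
  Components of a tensor in a frame are obtained by contracting its slots one after the other;
  iterating this one operation keeps every four-fold sum a composition of linear maps.
\<close>

definition contract :: "'k::field ^ 4 \<Rightarrow> (4 \<Rightarrow> 'k) \<Rightarrow> 'k" where
  "contract x f = (\<Sum>i\<in>UNIV. x $ i * f i)"

lemma contract_add: "contract x (\<lambda>i. f i + h i) = contract x f + contract x h"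
  and contract_diff: "contract x (\<lambda>i. f i - h i) = contract x f - contract x h"
  and contract_minus: "contract x (\<lambda>i. - f i) = - contract x f"
  and contract_mult_left: "contract x (\<lambda>i. c * f i) = c * contract x f"
  and contract_mult_right: "contract x (\<lambda>i. f i * c) = contract x f * c"
  and contract_divide: "contract x (\<lambda>i. f i / c) = contract x f / c"
  and contract_zero: "contract x (\<lambda>i. 0) = 0"
  by (simp_all add: contract_def algebra_simps sum.distrib sum_subtractf sum_negf sum_distrib_left
      sum_divide_distrib)

lemma contract_sum: "contract x (\<lambda>i. \<Sum>a\<in>A. f a i) = (\<Sum>a\<in>A. contract x (f a))"
  unfolding contract_def sum_distrib_left by (rule sum.swap)

lemma contract_swap: "contract x (\<lambda>i. contract y (f i)) = contract y (\<lambda>j. contract x (\<lambda>i. f i j))"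
  unfolding contract_def sum_distrib_left by (subst sum.swap) (simp add: mult.left_commute)

lemmas contract_linear = contract_add contract_diff contract_mult_left contract_mult_right
  contract_divide

section \<open>Determinants and the permutation symbol\<close>

lemma vector_4 [simp]:
  "(vector [x, y, z, w] :: 'a::zero ^ 4) $ 1 = x"
  "(vector [x, y, z, w] :: 'a::zero ^ 4) $ 2 = y"
  "(vector [x, y, z, w] :: 'a::zero ^ 4) $ 3 = z"
  "(vector [x, y, z, w] :: 'a::zero ^ 4) $ 4 = w"
  unfolding vector_def by simp_all

lemma det_4:
  "det (A :: 'a::comm_ring_1 ^ 4 ^ 4) =
     A$1$1 * A$2$2 * A$3$3 * A$4$4 - A$1$1 * A$2$2 * A$3$4 * A$4$3
   - A$1$1 * A$2$3 * A$3$2 * A$4$4 + A$1$1 * A$2$3 * A$3$4 * A$4$2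
   + A$1$1 * A$2$4 * A$3$2 * A$4$3 - A$1$1 * A$2$4 * A$3$3 * A$4$2
   - A$1$2 * A$2$1 * A$3$3 * A$4$4 + A$1$2 * A$2$1 * A$3$4 * A$4$3
   + A$1$2 * A$2$3 * A$3$1 * A$4$4 - A$1$2 * A$2$3 * A$3$4 * A$4$1
   - A$1$2 * A$2$4 * A$3$1 * A$4$3 + A$1$2 * A$2$4 * A$3$3 * A$4$1
   + A$1$3 * A$2$1 * A$3$2 * A$4$4 - A$1$3 * A$2$1 * A$3$4 * A$4$2
   - A$1$3 * A$2$2 * A$3$1 * A$4$4 + A$1$3 * A$2$2 * A$3$4 * A$4$1
   + A$1$3 * A$2$4 * A$3$1 * A$4$2 - A$1$3 * A$2$4 * A$3$2 * A$4$1
   - A$1$4 * A$2$1 * A$3$2 * A$4$3 + A$1$4 * A$2$1 * A$3$3 * A$4$2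
   + A$1$4 * A$2$2 * A$3$1 * A$4$3 - A$1$4 * A$2$2 * A$3$3 * A$4$1
   - A$1$4 * A$2$3 * A$3$1 * A$4$2 + A$1$4 * A$2$3 * A$3$2 * A$4$1"
proof -
  have f1234: "finite {2::4, 3, 4}" "1 \<notin> {2::4, 3, 4}" by auto
  have f234: "finite {3::4, 4}" "2 \<notin> {3::4, 4}" by auto
  have f34: "finite {4::4}" "3 \<notin> {4::4}" by auto
  show ?thesis
    unfolding det_def UNIV_4
    unfolding sum_over_permutations_insert[OF f1234]
    unfolding sum_over_permutations_insert[OF f234]
    unfolding sum_over_permutations_insert[OF f34]
    unfolding permutes_sing
    by (simp add: sign_swap_id permutation_swap_id permutation_compose sign_compose sign_id
        transpose_eq_iff Transposition.transpose_def algebra_simps)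
qed

lemma det_vector_contract:
  fixes x y z w :: "'k::field ^ 4"
  shows "contract x (\<lambda>i. det (vector [axis i 1, y, z, w])) = det (vector [x, y, z, w])"
    and "contract y (\<lambda>i. det (vector [x, axis i 1, z, w])) = det (vector [x, y, z, w])"
    and "contract z (\<lambda>i. det (vector [x, y, axis i 1, w])) = det (vector [x, y, z, w])"
    and "contract w (\<lambda>i. det (vector [x, y, z, axis i 1])) = det (vector [x, y, z, w])"
  by (simp_all add: contract_def sum_4 det_4 axis_def algebra_simps)

lemma levi_civita_contract:
  fixes x y z w :: "'k::field ^ 4"
  shows "contract x (\<lambda>i. contract y (\<lambda>j. contract z (\<lambda>m. contract w (\<lambda>n. levi_civita i j m n))))
    = det (vector [x, y, z, w])"
  by (simp add: levi_civita_def det_vector_contract)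

text \<open>
  This is the transformation law of the permutation symbol under a change of frame.
\<close>

lemma levi_civita_rows:
  "levi_civita a b c d * det A = det (vector [row a A, row b A, row c A, row d A] :: 'k::field ^ 4 ^ 4)"
proof -
  have "axis i 1 v* A = row i A" for i
    by (simp add: vector_matrix_mult_def row_def vec_eq_iff axis_def if_distrib[of "\<lambda>x. x * _"] cong: if_cong)
  then have "(vector [axis a 1, axis b 1, axis c 1, axis d 1] :: 'k ^ 4 ^ 4) ** A
      = vector [row a A, row b A, row c A, row d A]"
    by (simp add: vec_eq_iff forall_4 matrix_matrix_mult_def row_def vector_matrix_mult_def axis_def
        if_distrib[of "\<lambda>x. x * _"] cong: if_cong)
  then show ?thesis by (metis levi_civita_def det_mul)
qed

lemma levi_civita_repeat:
  "levi_civita i i m n = (0 :: 'k::field)" "levi_civita i m i n = (0 :: 'k)" "levi_civita i m n i = (0 :: 'k)"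
  "levi_civita m i i n = (0 :: 'k)" "levi_civita m i n i = (0 :: 'k)" "levi_civita m n i i = (0 :: 'k)"
  unfolding levi_civita_def det_4 vector_4 by (simp_all add: algebra_simps)

lemma levi_civita_perm:
  "levi_civita 1 2 3 4 = (1 :: 'k::field)" "levi_civita 1 2 4 3 = (-1 :: 'k)"
  "levi_civita 1 3 2 4 = (-1 :: 'k)" "levi_civita 1 3 4 2 = (1 :: 'k)"
  "levi_civita 1 4 2 3 = (1 :: 'k)" "levi_civita 1 4 3 2 = (-1 :: 'k)"
  "levi_civita 2 1 3 4 = (-1 :: 'k)" "levi_civita 2 1 4 3 = (1 :: 'k)"
  "levi_civita 2 3 1 4 = (1 :: 'k)" "levi_civita 2 3 4 1 = (-1 :: 'k)"
  "levi_civita 2 4 1 3 = (-1 :: 'k)" "levi_civita 2 4 3 1 = (1 :: 'k)"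
  "levi_civita 3 1 2 4 = (1 :: 'k)" "levi_civita 3 1 4 2 = (-1 :: 'k)"
  "levi_civita 3 2 1 4 = (-1 :: 'k)" "levi_civita 3 2 4 1 = (1 :: 'k)"
  "levi_civita 3 4 1 2 = (1 :: 'k)" "levi_civita 3 4 2 1 = (-1 :: 'k)"
  "levi_civita 4 1 2 3 = (-1 :: 'k)" "levi_civita 4 1 3 2 = (1 :: 'k)"
  "levi_civita 4 2 1 3 = (1 :: 'k)" "levi_civita 4 2 3 1 = (-1 :: 'k)"
  "levi_civita 4 3 1 2 = (-1 :: 'k)" "levi_civita 4 3 2 1 = (1 :: 'k)"
  unfolding levi_civita_def det_4 vector_4 by (simp_all add: axis_def)

section \<open>Self-duality in a null frame\<close>

text \<open>
  The inner products of a null frame with \<open>g = 2 (m\<^sub>1 m\<^sub>2 - m\<^sub>3 m\<^sub>4)\<close>.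
\<close>

definition null_form :: "'k::field ^ 4 ^ 4" where
  "null_form = vector [vector [0, 1, 0, 0], vector [1, 0, 0, 0], vector [0, 0, 0, -1], vector [0, 0, -1, 0]]"

lemma null_form_involution: "null_form ** null_form = mat 1"
  by (simp add: null_form_def vec_eq_iff forall_4 matrix_matrix_mult_def sum_4 mat_def)

lemma null_form_sym: "transpose null_form = null_form"
  by (simp add: null_form_def vec_eq_iff forall_4 transpose_def)

text \<open>
  For the volume form with value \<open>-1\<close> on the frame, the self-dual two-forms are spanned by
  \<open>m\<^sub>1 \<and> m\<^sub>4\<close>, \<open>m\<^sub>2 \<and> m\<^sub>3\<close> and \<open>m\<^sub>1 \<and> m\<^sub>2 + m\<^sub>3 \<and> m\<^sub>4\<close>.
\<close>

lemma hodge4_null_form: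
  fixes F :: "4 \<Rightarrow> 4 \<Rightarrow> 'k::field_char_0"
  assumes F: "\<And>a b. F b a = - F a b"
  defines "D \<equiv> hodge4 null_form (-1) F"
  shows "D i i = 0" "D j i = - D i j" "D 1 2 = F 3 4" "D 3 4 = F 1 2" "D 1 4 = F 1 4" "D 2 3 = F 2 3"
    "D 1 3 = - F 1 3" "D 2 4 = - F 2 4"
proof -
  have inv: "matrix_inv null_form = (null_form :: 'k ^ 4 ^ 4)"
    by (intro matrix_inv_eq null_form_involution)
  have Fi: "F i i = 0" for i using F[of i i] by simp
  have D: "D i j = - (\<Sum>m\<in>UNIV. \<Sum>n\<in>UNIV. levi_civita i j m n *
     (\<Sum>a\<in>UNIV. \<Sum>b\<in>UNIV. null_form $ m $ a * null_form $ n $ b * F a b)) / 2" for i j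
    unfolding D_def hodge4_def inv by (simp add: sum_distrib_left sum_negf mult.assoc)
  show "D i i = 0" by (simp add: D levi_civita_repeat)
  have "levi_civita j i m n = - (levi_civita i j m n :: 'k)" for m n
    unfolding levi_civita_def det_4 vector_4 by (simp add: algebra_simps)
  then show "D j i = - D i j" by (simp only: D mult_minus_left sum_negf minus_divide_left)
  show "D 1 2 = F 3 4" "D 3 4 = F 1 2" "D 1 4 = F 1 4" "D 2 3 = F 2 3" "D 1 3 = - F 1 3" "D 2 4 = - F 2 4"
    using F[of 1 2] F[of 1 3] F[of 1 4] F[of 2 3] F[of 2 4] F[of 3 4]
    by (simp_all add: D sum_4 levi_civita_repeat levi_civita_perm null_form_def)
qed

lemma hodge4_eq:
  "hodge4 G w F i j = w * (\<Sum>m\<in>UNIV. \<Sum>n\<in>UNIV.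
     (matrix_inv G ** (\<chi> a b. F a b) ** transpose (matrix_inv G)) $ m $ n * levi_civita i j m n) / 2"
proof -
  have "(matrix_inv G ** (\<chi> a b. F a b) ** transpose (matrix_inv G)) $ m $ n
      = (\<Sum>a\<in>UNIV. \<Sum>b\<in>UNIV. matrix_inv G $ m $ a * matrix_inv G $ n $ b * F a b)" for m n
    unfolding matrix_mul_assoc[symmetric]
    by (simp add: matrix_matrix_mult_def transpose_def sum_distrib_left mult_ac)
  then show ?thesis
    by (simp add: hodge4_def sum_distrib_left sum_distrib_right mult_ac)
qed

definition ricci_frame :: "(4 \<Rightarrow> 4 \<Rightarrow> 4 \<Rightarrow> 4 \<Rightarrow> 'k::field) \<Rightarrow> 4 \<Rightarrow> 4 \<Rightarrow> 'k" where
  "ricci_frame R b d = (\<Sum>a\<in>UNIV. \<Sum>c\<in>UNIV. null_form $ a $ c * R c b a d)"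

definition weyl_frame :: "(4 \<Rightarrow> 4 \<Rightarrow> 4 \<Rightarrow> 4 \<Rightarrow> 'k::field) \<Rightarrow> 4 \<Rightarrow> 4 \<Rightarrow> 4 \<Rightarrow> 4 \<Rightarrow> 'k" where
  "weyl_frame R l k i j = R l k i j
     - (null_form $ l $ i * ricci_frame R k j - null_form $ l $ j * ricci_frame R k i
        - null_form $ k $ i * ricci_frame R l j + null_form $ k $ j * ricci_frame R l i) / 2
     + (\<Sum>a\<in>UNIV. \<Sum>b\<in>UNIV. null_form $ a $ b * ricci_frame R a b) / 6
       * (null_form $ l $ i * null_form $ k $ j - null_form $ l $ j * null_form $ k $ i)"

lemma pair_symmetry:
  fixes R :: "4 \<Rightarrow> 4 \<Rightarrow> 4 \<Rightarrow> 4 \<Rightarrow> 'k::field_char_0"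
  assumes s1: "\<And>a b c d. R b a c d = - R a b c d" and s2: "\<And>a b c d. R a b d c = - R a b c d"
    and cyc: "\<And>a b c d. R a b c d + R a c d b + R a d b c = 0"
  shows "R a b c d = R c d a b"
proof -
  have "2 * (R a b c d - R c d a b)
      = (R a b c d + R a c d b + R a d b c) - (R b a c d + R b c d a + R b d a c)
        - (R c a b d + R c b d a + R c d a b) + (R d a b c + R d b c a + R d c a b)"
    unfolding s1[of b a c d] s1[of a c b d] s2[of a c d b] s1[of b c d a] s1[of a d b c]
      s1[of b d c a] s2[of b d a c] s1[of c d a b]
    by simp
  also have "\<dots> = 0" by (simp add: cyc)
  finally show ?thesis by simp
qed

text \<open>
  By the hypotheses \<open>R14\<close> and \<open>R12\<close>, among the self-dual index pairs only \<open>23\<close> survives in the first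
  two slots of \<open>R\<close>, and by pair symmetry the same holds in the last two slots. Together with \<open>R23\<close>
  the whole block of the curvature operator from self-dual to self-dual forms is zero. This block
  is the self-dual Weyl tensor plus a multiple of the scalar curvature, and its trace shows that the
  scalar curvature vanishes; the mixed block is trace-free Ricci and does not enter.
\<close>

lemma weyl_frame_self_dual_part:
  fixes R :: "4 \<Rightarrow> 4 \<Rightarrow> 4 \<Rightarrow> 4 \<Rightarrow> 'k::field_char_0"
  assumes s1: "\<And>a b c d. R b a c d = - R a b c d" and s2: "\<And>a b c d. R a b d c = - R a b c d"
    and cyc: "\<And>a b c d. R a b c d + R a c d b + R a d b c = 0"
    and R14: "\<And>c d. R 1 4 c d = 0" and R12: "\<And>c d. R 1 2 c d + R 3 4 c d = 0"
    and R23: "R 2 3 2 3 = 0"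
  shows "weyl_frame R a b c d + hodge4 null_form (-1) (\<lambda>a b. weyl_frame R a b c d) a b = 0"
proof -
  have pair: "R a b c d = R c d a b" for a b c d
    by (rule pair_symmetry) (fact s1 s2 cyc)+
  have z: "R a a c d = 0" "R a b c c = 0" for a b c d
    using s1[of a a c d] s2[of a b c c] by simp_all
  have o1: "R 2 1 c d = - R 1 2 c d" "R 3 1 c d = - R 1 3 c d" "R 4 1 c d = - R 1 4 c d"
    "R 3 2 c d = - R 2 3 c d" "R 4 2 c d = - R 2 4 c d" "R 4 3 c d = - R 3 4 c d" for c d
    by (fact s1)+
  have o2: "R c d 2 1 = - R c d 1 2" "R c d 3 1 = - R c d 1 3" "R c d 4 1 = - R c d 1 4"
    "R c d 3 2 = - R c d 2 3" "R c d 4 2 = - R c d 2 4" "R c d 4 3 = - R c d 3 4" for c d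
    by (fact s2)+
  have r12: "R 1 2 c d = - R 3 4 c d" for c d
    using R12[of c d] by (simp add: eq_neg_iff_add_eq_0)
  have r12': "R c d 1 2 = - R c d 3 4" and r14': "R c d 1 4 = 0" for c d
    using r12[of c d] R14[of c d] pair[of c d 1 2] pair[of c d 3 4] pair[of c d 1 4] by simp_all
  have o3: "R 3 4 1 3 = R 1 3 3 4" "R 3 4 2 3 = R 2 3 3 4" "R 3 4 2 4 = R 2 4 3 4"
    "R 2 3 1 3 = R 1 3 2 3" "R 2 4 1 3 = R 1 3 2 4" "R 2 4 2 3 = R 2 3 2 4"
    by (fact pair)+
  have r1324: "R 1 3 2 4 = - R 3 4 3 4"
    using cyc[of 1 2 3 4] by (simp add: o1 o2 r12 R14 add_eq_0_iff)
  note rules = z o1 o2 o3 r12 r12' r14' R14 R23 r1324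
  define W where "W = weyl_frame R"
  have W: "W l k i j = R l k i j
     - (null_form $ l $ i * ricci_frame R k j - null_form $ l $ j * ricci_frame R k i
        - null_form $ k $ i * ricci_frame R l j + null_form $ k $ j * ricci_frame R l i) / 2
     + (\<Sum>a\<in>UNIV. \<Sum>b\<in>UNIV. null_form $ a $ b * ricci_frame R a b) / 6
       * (null_form $ l $ i * null_form $ k $ j - null_form $ l $ j * null_form $ k $ i)" for l k i j
    by (simp add: W_def weyl_frame_def)
  have Ric: "ricci_frame R b d = R 2 b 1 d + R 1 b 2 d - R 4 b 3 d - R 3 b 4 d" for b d
    by (simp add: ricci_frame_def sum_4 null_form_def)
  have scal: "(\<Sum>a\<in>UNIV. \<Sum>b\<in>UNIV. null_form $ a $ b * ricci_frame R a b) = 0"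
    unfolding sum_4 by (simp add: null_form_def Ric rules)
  have skewW: "W b a c d = - W a b c d" for a b c d
    by (simp add: W s1[of a b] scal algebra_simps minus_divide_left add_divide_distrib diff_divide_distrib)
  have "\<forall>c d. W 1 4 c d = 0 \<and> W 2 3 c d = 0 \<and> W 1 2 c d = - W 3 4 c d"
    by (simp add: forall_4 W[unfolded scal] Ric rules null_form_def)
  then have W0: "W 1 4 c d = 0" "W 2 3 c d = 0" "W 1 2 c d = - W 3 4 c d" for c d
    by blast+
  note D = hodge4_null_form[of "\<lambda>a b. W a b c d", OF skewW]
  have Wz: "W a a c d = 0" for a using skewW[of a a c d] by simp
  have "\<forall>a b. W a b c d + hodge4 null_form (-1) (\<lambda>a b. W a b c d) a b = 0"
    unfolding forall_4
    by (simp add: D(1,3-8) D(2)[of 2 1] D(2)[of 3 1] D(2)[of 4 1] D(2)[of 3 2] D(2)[of 4 2] D(2)[of 4 3]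
        skewW[of 2 1] skewW[of 3 1] skewW[of 4 1] skewW[of 3 2] skewW[of 4 2] skewW[of 4 3] W0 Wz)
  then show ?thesis by (simp add: W_def)
qed

section \<open>Curvature evaluated in a moving frame\<close>

context moving_frame
begin

abbreviation e :: "'k ^ 4 \<Rightarrow> 4 \<Rightarrow> 'k ^ 4" where
  "e p a \<equiv> column a (E p)"

lemma contract_e: "contract (e p a) f = (\<Sum>i\<in>UNIV. E p $ i $ a * f i)"
  by (simp add: contract_def column_def)

lemma contract_matrix:
  "contract (e p a) (\<lambda>i. contract (e p b) (\<lambda>j. M $ i $ j)) = (transpose (E p) ** (M ** E p)) $ a $ b"
  by (simp add: contract_e matrix_matrix_mult_def transpose_def mult.commute)

lemma contract_e_vanish:
  assumes p: "p \<in> S" and 0: "\<And>a. contract (e p a) f = 0"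
  shows "f i = 0"
proof -
  have "f i = (\<Sum>j\<in>UNIV. (\<Sum>a\<in>UNIV. E p $ j $ a * \<Theta> p $ a $ i) * f j)"
  proof -
    have "(\<Sum>a\<in>UNIV. E p $ j $ a * \<Theta> p $ a $ i) = (if j = i then 1 else 0)" for j
      using arg_cong[OF frame_coframe[OF p], of "\<lambda>M. M $ j $ i"]
      by (simp add: matrix_matrix_mult_def mat_def)
    then show ?thesis by (simp add: if_distrib[of "\<lambda>x. x * _"] cong: if_cong)
  qed
  also have "\<dots> = (\<Sum>a\<in>UNIV. \<Theta> p $ a $ i * contract (e p a) f)"
    unfolding contract_e sum_distrib_left sum_distrib_right by (subst sum.swap) (simp add: mult_ac)
  finally show ?thesis by (simp add: 0)
qed

lemma contract_metric:
  assumes p: "p \<in> S"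
  shows "contract (e p a) (\<lambda>i. contract (e p b) (\<lambda>j. g p $ i $ j)) = H $ a $ b"
proof -
  have "transpose (E p) ** (g p ** E p) = H"
    by (simp add: frame_metric[OF p] matrix_mul_assoc)
  then show ?thesis by (simp add: contract_matrix)
qed

lemma frame_sum:
  "(\<Sum>i\<in>UNIV. \<Sum>j\<in>UNIV. (E p ** K ** transpose (E p)) $ i $ j * f i j)
    = (\<Sum>a\<in>UNIV. \<Sum>b\<in>UNIV. K $ a $ b * contract (e p a) (\<lambda>i. contract (e p b) (f i)))"
proof -
  have "(E p ** K ** transpose (E p)) $ i $ j = (\<Sum>b\<in>UNIV. \<Sum>a\<in>UNIV. E p $ i $ a * K $ a $ b * E p $ j $ b)" for i j
    by (simp add: matrix_matrix_mult_def transpose_def sum_distrib_right)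
  then have "(\<Sum>i\<in>UNIV. \<Sum>j\<in>UNIV. (E p ** K ** transpose (E p)) $ i $ j * f i j)
    = (\<Sum>i\<in>UNIV. \<Sum>j\<in>UNIV. \<Sum>b\<in>UNIV. \<Sum>a\<in>UNIV. K $ a $ b * (E p $ i $ a * (E p $ j $ b * f i j)))"
    by (simp add: sum_distrib_right sum_distrib_left mult_ac)
  also have "\<dots> = (\<Sum>i\<in>UNIV. \<Sum>b\<in>UNIV. \<Sum>j\<in>UNIV. \<Sum>a\<in>UNIV. K $ a $ b * (E p $ i $ a * (E p $ j $ b * f i j)))"
    by (rule sum.cong[OF refl]) (rule sum.swap)
  also have "\<dots> = (\<Sum>b\<in>UNIV. \<Sum>i\<in>UNIV. \<Sum>a\<in>UNIV. \<Sum>j\<in>UNIV. K $ a $ b * (E p $ i $ a * (E p $ j $ b * f i j)))"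
    by (subst sum.swap) (rule sum.cong[OF refl], rule sum.cong[OF refl], rule sum.swap)
  also have "\<dots> = (\<Sum>b\<in>UNIV. \<Sum>a\<in>UNIV. \<Sum>i\<in>UNIV. \<Sum>j\<in>UNIV. K $ a $ b * (E p $ i $ a * (E p $ j $ b * f i j)))"
    by (rule sum.cong[OF refl]) (rule sum.swap)
  also have "\<dots> = (\<Sum>a\<in>UNIV. \<Sum>b\<in>UNIV. \<Sum>i\<in>UNIV. \<Sum>j\<in>UNIV. K $ a $ b * (E p $ i $ a * (E p $ j $ b * f i j)))"
    by (rule sum.swap)
  finally show ?thesis by (simp add: contract_e sum_distrib_left)
qed

lemma inverse_metric_sum:
  assumes p: "p \<in> S"
  shows "(\<Sum>i\<in>UNIV. \<Sum>j\<in>UNIV. matrix_inv (g p) $ i $ j * f i j)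
    = (\<Sum>a\<in>UNIV. \<Sum>b\<in>UNIV. H $ a $ b * contract (e p a) (\<lambda>i. contract (e p b) (f i)))"
  unfolding metric_inv[OF p] by (rule frame_sum)

definition R_frame :: "'k ^ 4 \<Rightarrow> 4 \<Rightarrow> 4 \<Rightarrow> 4 \<Rightarrow> 4 \<Rightarrow> 'k" where
  "R_frame p a b c d = contract (e p a) (\<lambda>l. contract (e p b) (\<lambda>k.
     contract (e p c) (\<lambda>i. contract (e p d) (\<lambda>j. riemann g l k i j p))))"

lemma contract_curv:
  assumes p: "p \<in> S"
  shows "contract (e p a) (\<lambda>l. contract (e p b) (\<lambda>k. riemann g l k i j p)) = (H ** curv i j p) $ a $ b"
proof -
  have eq: "transpose (E p) ** ((transpose (\<Theta> p) ** (H ** curv i j p) ** \<Theta> p) ** E p) = H ** curv i j p"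
    by (simp add: matrix_mul_assoc transpose_coframe_frame[OF p] coframe_frame_cancel[OF p])
  show ?thesis unfolding riemann_eq[OF p] contract_matrix eq ..
qed

lemma R_frame_eq:
  assumes p: "p \<in> S"
  shows "R_frame p a b c d = contract (e p c) (\<lambda>i. contract (e p d) (\<lambda>j. (H ** curv i j p) $ a $ b))"
proof -
  have "R_frame p a b c d = contract (e p a) (\<lambda>l. contract (e p c) (\<lambda>i. contract (e p d) (\<lambda>j.
      contract (e p b) (\<lambda>k. riemann g l k i j p))))"
    unfolding R_frame_def
    by (simp only: contract_swap[of "e p b" "e p c"] contract_swap[of "e p b" "e p d"])
  also have "\<dots> = contract (e p c) (\<lambda>i. contract (e p d) (\<lambda>j. contract (e p a) (\<lambda>l.
      contract (e p b) (\<lambda>k. riemann g l k i j p))))"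
    by (simp only: contract_swap[of "e p a" "e p c"] contract_swap[of "e p a" "e p d"])
  finally show ?thesis by (simp add: contract_curv[OF p])
qed

lemma riemann_skew12:
  assumes p: "p \<in> S" shows "R_frame p b a c d = - R_frame p a b c d"
proof -
  have "(H ** curv i j p) $ b $ a = - (H ** curv i j p) $ a $ b" for i j
    using arg_cong[OF curv_skew[OF p, of i j], of "\<lambda>M. M $ a $ b"] by (simp add: transpose_def)
  then show ?thesis by (simp add: R_frame_eq[OF p] contract_minus)
qed

lemma riemann_skew34:
  assumes p: "p \<in> S" shows "R_frame p a b d c = - R_frame p a b c d"
proof -
  have "riemann_up g m k j i p = - riemann_up g m k i j p" for m k i j
    unfolding riemann_up_def by (simp add: sum_subtractf)
  then have "riemann g l k j i p = - riemann g l k i j p" for l k i j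
    unfolding riemann_def sum_negf[symmetric] mult_minus_right[symmetric]
    by (intro sum.cong refl arg_cong2[of _ _ _ _ "(*)"])
  then have "contract (e p c) (\<lambda>j. contract (e p d) (\<lambda>i. riemann g l k i j p))
      = contract (e p c) (\<lambda>i. contract (e p d) (\<lambda>j. - riemann g l k i j p))" for l k
    by (intro arg_cong[of _ _ "contract (e p c)"] arg_cong[of _ _ "contract (e p d)"] ext)
  then show ?thesis
    unfolding R_frame_def contract_swap[of "e p d" "e p c"] by (simp add: contract_minus)
qed

lemma bianchi:
  assumes p: "p \<in> S"
  shows "R_frame p a b c d + R_frame p a c d b + R_frame p a d b c = 0"
proof -
  have sym: "christoffel g l i j q = christoffel g l j i q" if "q \<in> S" for l i j q
    using torsion_free[OF that, of i _ j]
    by (simp add: christoffel_eq[OF that] conn_def matrix_matrix_mult_def[of "E q"])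
  have dsym: "partial_deriv k (christoffel g l i j) p = partial_deriv k (christoffel g l j i) p" for k l i j
    by (rule partial_deriv_cong_open[OF open_S p]) (rule sym)
  have up: "riemann_up g l k i j p + riemann_up g l i j k p + riemann_up g l j k i p = 0" for l k i j
  proof -
    have "(\<Sum>m\<in>UNIV. christoffel g l i m p * christoffel g m j k p - christoffel g l j m p * christoffel g m i k p)
        + (\<Sum>m\<in>UNIV. christoffel g l j m p * christoffel g m k i p - christoffel g l k m p * christoffel g m j i p)
        + (\<Sum>m\<in>UNIV. christoffel g l k m p * christoffel g m i j p - christoffel g l i m p * christoffel g m k j p) = 0"
      unfolding sum.distrib[symmetric]
      by (rule sum.neutral) (simp add: sym[OF p, of _ j i] sym[OF p, of _ k i] sym[OF p, of _ k j])
    then show ?thesis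
      unfolding riemann_up_def dsym[of _ _ k j] dsym[of _ _ k i] dsym[of _ _ j i]
      by (simp add: algebra_simps)
  qed
  have *: "riemann g l k i j p + riemann g l i j k p + riemann g l j k i p = 0" for l k i j
    unfolding riemann_def sum.distrib[symmetric] distrib_left[symmetric] up by simp
  have 2: "R_frame p a c d b = contract (e p a) (\<lambda>l. contract (e p b) (\<lambda>k. contract (e p c) (\<lambda>i. contract (e p d) (\<lambda>j. riemann g l i j k p))))"
    unfolding R_frame_def
    by (simp only: contract_swap[of "e p d" "e p b"] contract_swap[of "e p c" "e p b"])
  have 3: "R_frame p a d b c = contract (e p a) (\<lambda>l. contract (e p b) (\<lambda>k. contract (e p c) (\<lambda>i. contract (e p d) (\<lambda>j. riemann g l j k i p))))"
    unfolding R_frame_def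
    by (simp only: contract_swap[of "e p d" "e p b"] contract_swap[of "e p d" "e p c"])
  show ?thesis
    unfolding 2 3 unfolding R_frame_def by (simp add: contract_add[symmetric] * contract_zero)
qed

lemma contract_ricci:
  assumes p: "p \<in> S"
  shows "contract (e p b) (\<lambda>k. contract (e p d) (\<lambda>j. ricci g k j p))
    = (\<Sum>a\<in>UNIV. \<Sum>c\<in>UNIV. H $ a $ c * R_frame p c b a d)"
proof -
  have "riemann_up g i k i' j p = (\<Sum>l\<in>UNIV. matrix_inv (g p) $ i $ l * riemann g l k i' j p)" for i k i' j
  proof -
    have "(matrix_inv (g p) ** g p) $ i $ m = (if i = m then 1 else 0)" for m
      by (simp add: metric_inv[OF p] metric_inv_left[OF p] mat_def)
    then have "riemann_up g i k i' j p = (\<Sum>m\<in>UNIV. (matrix_inv (g p) ** g p) $ i $ m * riemann_up g m k i' j p)"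
      by (simp add: if_distrib[of "\<lambda>x. x * _"] cong: if_cong)
    then show ?thesis
      unfolding riemann_def matrix_matrix_mult_def
      by (simp add: sum_distrib_left sum_distrib_right mult.assoc) (rule sum.swap)
  qed
  then have ric: "ricci g k j p = (\<Sum>a\<in>UNIV. \<Sum>c\<in>UNIV. H $ a $ c *
      contract (e p a) (\<lambda>i. contract (e p c) (\<lambda>l. riemann g l k i j p)))" for k j
    by (simp add: ricci_def inverse_metric_sum[OF p])
  have "contract (e p b) (\<lambda>k. contract (e p d) (\<lambda>j. contract (e p a) (\<lambda>i. contract (e p c) (\<lambda>l. riemann g l k i j p))))
      = R_frame p c b a d" for a c
    unfolding R_frame_def
    by (simp only: contract_swap[of "e p a" "e p c"] contract_swap[of "e p d" "e p c"]
        contract_swap[of "e p b" "e p c"] contract_swap[of "e p d" "e p a"])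
  then show ?thesis
    by (simp add: ric contract_sum contract_mult_left)
qed

text \<open>
  The Hodge operator commutes with the passage to frame components, since the permutation symbol
  picks up \<open>det E\<close>, which cancels against the volume form up to the sign that fixes the orientation.
\<close>

lemma contract_hodge4:
  assumes p: "p \<in> S" and w: "w = - det (\<Theta> p)"
  shows "contract (e p a) (\<lambda>i. contract (e p b) (\<lambda>j. hodge4 (g p) w F i j))
    = hodge4 H (-1) (\<lambda>c d. contract (e p c) (\<lambda>i. contract (e p d) (F i))) a b"
proof -
  define N where "N = transpose (E p) ** (\<chi> i j. F i j) ** E p"
  have N: "N = (\<chi> c d. contract (e p c) (\<lambda>i. contract (e p d) (F i)))"
    unfolding N_def matrix_mul_assoc[symmetric]
    using contract_matrix[where p = p and M = "\<chi> i j. F i j"] by (simp add: vec_eq_iff)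
  define K where "K = H ** N ** H"
  have inv_H: "matrix_inv H = H" by (intro matrix_inv_eq H_involution)
  have up: "matrix_inv (g p) ** (\<chi> a b. F a b) ** transpose (matrix_inv (g p)) = E p ** K ** transpose (E p)"
    by (simp add: metric_inv[OF p] K_def N_def matrix_transpose_mul H_sym matrix_mul_assoc)
  have eps: "contract (e p a) (\<lambda>i. contract (e p b) (\<lambda>j. contract (e p c) (\<lambda>m. contract (e p d) (\<lambda>n.
      levi_civita i j m n)))) = levi_civita a b c d * det (E p)" for c d
    using levi_civita_rows[of a b c d "transpose (E p)"]
    by (simp add: levi_civita_contract row_transpose)
  have "det (\<Theta> p) * det (E p) = 1"
    using arg_cong[OF coframe_frame[OF p], of det] by (simp add: det_mul)
  then have wE: "w * (x * (y * det (E p))) = - (x * y)" for x y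
    by (simp add: w mult.left_commute)
  have "contract (e p a) (\<lambda>i. contract (e p b) (\<lambda>j. hodge4 (g p) w F i j))
      = w * (\<Sum>c\<in>UNIV. \<Sum>d\<in>UNIV. K $ c $ d * (levi_civita a b c d * det (E p))) / 2"
    unfolding hodge4_eq up frame_sum
    by (simp add: contract_divide contract_mult_left contract_sum eps)
  also have "\<dots> = - (\<Sum>c\<in>UNIV. \<Sum>d\<in>UNIV. K $ c $ d * levi_civita a b c d) / 2"
    by (simp add: sum_distrib_left wE sum_negf)
  finally show ?thesis
    by (simp add: hodge4_eq inv_H H_sym K_def N)
qed

text \<open>
  By naturality of all constructions, the components of the self-dual part of the Weyl tensor in the
  frame are those of the purely algebraic statement \<open>weyl_frame_self_dual_part\<close>, whose hypotheses are
  three conditions on the matrix of curvature two-forms.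
\<close>

lemma weyl_self_dual_part_vanishes:
  assumes p: "p \<in> S" and H: "H = null_form" and w: "w p = - det (\<Theta> p)"
    and R14: "\<And>i j. (H ** curv i j p) $ 1 $ 4 = 0"
    and R12: "\<And>i j. (H ** curv i j p) $ 1 $ 2 + (H ** curv i j p) $ 3 $ 4 = 0"
    and R23: "contract (e p 2) (\<lambda>i. contract (e p 3) (\<lambda>j. (H ** curv i j p) $ 2 $ 3)) = 0"
  shows "weyl_self_dual_part g w i j k l p = 0"
proof -
  note R = R_frame_eq[OF p]
  have "R_frame p 1 4 c d = 0" for c d
    by (simp add: R R14 contract_zero)
  moreover have "R_frame p 1 2 c d + R_frame p 3 4 c d = 0" for c d
    by (simp add: R contract_add[symmetric] R12 contract_zero)
  moreover have "R_frame p 2 3 2 3 = 0" by (simp add: R R23)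
  ultimately have frame0: "weyl_frame (R_frame p) a b c d + hodge4 H (-1) (\<lambda>a b. weyl_frame (R_frame p) a b c d) a b = 0"
    for a b c d
    unfolding H
    by (intro weyl_frame_self_dual_part riemann_skew12[OF p] riemann_skew34[OF p] bianchi[OF p])
  have scal: "scalar_curvature g p = (\<Sum>a\<in>UNIV. \<Sum>b\<in>UNIV. H $ a $ b * ricci_frame (R_frame p) a b)"
    by (simp add: scalar_curvature_def inverse_metric_sum[OF p] contract_ricci[OF p] ricci_frame_def H)
  have ric: "ricci_frame (R_frame p) b d = (\<Sum>a\<in>UNIV. \<Sum>c\<in>UNIV. H $ a $ c * R_frame p c b a d)" for b d
    by (simp add: ricci_frame_def H)
  have weyl: "contract (e p a) (\<lambda>l. contract (e p b) (\<lambda>k. contract (e p c) (\<lambda>i. contract (e p d) (\<lambda>j.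
      weyl g l k i j p)))) = weyl_frame (R_frame p) a b c d" for a b c d
    unfolding weyl_def
    by (simp add: contract_linear contract_metric[OF p] contract_ricci[OF p] scal weyl_frame_def
        R_frame_def[symmetric] ric H[symmetric])
  define T where "T i j k l = weyl g i j k l p + hodge4 (g p) (w p) (\<lambda>a b. weyl g a b k l p) i j" for i j k l
  have T4: "contract (e p a) (\<lambda>i. contract (e p b) (\<lambda>j. contract (e p c) (\<lambda>k. contract (e p d) (T i j k)))) = 0"
    for a b c d
  proof -
    have "contract (e p a) (\<lambda>i. contract (e p b) (\<lambda>j. contract (e p c) (\<lambda>k. contract (e p d) (\<lambda>l.
        hodge4 (g p) (w p) (\<lambda>a b. weyl g a b k l p) i j))))
      = contract (e p c) (\<lambda>k. contract (e p d) (\<lambda>l. hodge4 H (-1) (\<lambda>a b.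
          contract (e p a) (\<lambda>i. contract (e p b) (\<lambda>j. weyl g i j k l p))) a b))"
      by (simp only: contract_swap[of "e p b" "e p c"] contract_swap[of "e p b" "e p d"]
          contract_swap[of "e p a" "e p c"] contract_swap[of "e p a" "e p d"] contract_hodge4[OF p w])
    also have "\<dots> = hodge4 H (-1) (\<lambda>a b. weyl_frame (R_frame p) a b c d) a b"
    proof -
      have "contract (e p c) (\<lambda>k. contract (e p d) (\<lambda>l.
          contract (e p a) (\<lambda>i. contract (e p b) (\<lambda>j. weyl g i j k l p)))) = weyl_frame (R_frame p) a b c d" for a b
        unfolding weyl[symmetric]
        by (simp only: contract_swap[of "e p d" "e p a"] contract_swap[of "e p d" "e p b"]
          contract_swap[of "e p c" "e p a"] contract_swap[of "e p c" "e p b"])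
      then show ?thesis
        unfolding hodge4_def by (simp add: contract_divide contract_sum contract_mult_left contract_minus)
    qed
    finally show ?thesis
      unfolding T_def by (simp add: contract_add weyl frame0)
  qed
  have T3: "contract (e p b) (\<lambda>j. contract (e p c) (\<lambda>k. contract (e p d) (T i j k))) = 0" for i b c d
    by (rule contract_e_vanish[OF p T4])
  have T2: "contract (e p c) (\<lambda>k. contract (e p d) (T i j k)) = 0" for i j c d
    by (rule contract_e_vanish[OF p T3])
  have T1: "contract (e p d) (T i j k) = 0" for i j k d
    by (rule contract_e_vanish[OF p T2])
  have "T i j k l = 0"
    by (rule contract_e_vanish[OF p T1])
  then show ?thesis by (simp add: weyl_self_dual_part_def T_def)
qed

end

section \<open>Pull-back along the projection\<close>

text \<open>
  Functions on the base do not depend on \<open>z\<close>, so their pull-backs have no derivative in the fourth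
  direction.
\<close>

definition lifted_partial :: "4 \<Rightarrow> ('k::real_normed_field ^ 3 \<Rightarrow> 'k) \<Rightarrow> 'k ^ 3 \<Rightarrow> 'k" where
  "lifted_partial i f q = (if i = 1 then D\<^sub>x f q else if i = 2 then D\<^sub>y f q else if i = 3 then D\<^sub>t f q else 0)"

lemma lifted_partial_simps [simp]:
  "lifted_partial 1 f q = D\<^sub>x f q" "lifted_partial 2 f q = D\<^sub>y f q"
  "lifted_partial 3 f q = D\<^sub>t f q" "lifted_partial 4 f q = 0"
  by (simp_all add: lifted_partial_def)

lemma base_proj_line:
  "base_proj (p + s *s axis 1 1) = base_proj p + s *s axis 1 1"
  "base_proj (p + s *s axis 2 1) = base_proj p + s *s axis 2 1"
  "base_proj (p + s *s axis 3 1) = base_proj p + s *s axis 3 1"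
  "base_proj (p + s *s axis 4 1) = base_proj p"
  by (simp_all add: base_proj_def vec_eq_iff forall_3 axis_def)

lemma continuous_base_proj: "continuous_on S (base_proj :: 'k::real_normed_field ^ 4 \<Rightarrow> 'k ^ 3)"
proof -
  have "continuous_on S (\<lambda>p::'k ^ 4. base_proj p $ i)" for i
    using exhaust_3[of i] by (elim disjE) (simp_all add: base_proj_def continuous_on_component[OF continuous_on_id])
  then have "continuous_on S (\<lambda>p::'k ^ 4. \<chi> i. base_proj p $ i)"
    by (rule continuous_on_vec_lambda)
  then show ?thesis by simp
qed

lemma open_base_proj_vimage: "open W \<Longrightarrow> open (base_proj -` W)"
  by (rule open_vimage[OF _ continuous_base_proj])

lemma has_partial_base_proj:
  assumes "smooth_on W f" "base_proj p \<in> W"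
  shows "has_partial i (\<lambda>q. f (base_proj q)) (lifted_partial i f (base_proj p)) p"
  using exhaust_4[of i] smooth_on_has_partial[OF assms]
  by (auto simp: has_partial_def base_proj_line)

lemma partial_base_proj:
  assumes "smooth_on W f" "base_proj p \<in> W"
  shows "partial_deriv i (\<lambda>q. f (base_proj q)) p = lifted_partial i f (base_proj p)"
  by (rule partial_deriv_eq[OF has_partial_base_proj[OF assms]])

lemma smooth_on_base_proj:
  assumes "open W" "smooth_on W f"
  shows "smooth_on (base_proj -` W) (\<lambda>p. f (base_proj p))"
proof -
  have "Ck_on k (base_proj -` W) (\<lambda>p. f (base_proj p))" if "smooth_on W f" for k f
    using that
  proof (induction k arbitrary: f)
    case (Suc k)
    show ?case
    proof (rule Ck_on_SucI[where f'="\<lambda>i p. lifted_partial i f (base_proj p)"])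
      show "continuous_on (base_proj -` W) (\<lambda>p. f (base_proj p))"
        using Suc.IH[OF Suc.prems] by (rule Ck_on_continuous)
      show "has_partial i (\<lambda>p. f (base_proj p)) (lifted_partial i f (base_proj p)) p"
        if "p \<in> base_proj -` W" for i p
        using that Suc.prems by (intro has_partial_base_proj[of W]) auto
      show "Ck_on k (base_proj -` W) (\<lambda>p. lifted_partial i f (base_proj p))" for i
        using exhaust_4[of i] Suc.IH[OF smooth_on_partial[OF Suc.prems]]
          Ck_on_const[OF open_base_proj_vimage[OF assms(1)], of k 0]
        by auto
    qed (rule open_base_proj_vimage[OF assms(1)])
  next
    case 0
    then show ?case
      by (auto intro!: continuous_on_compose2[OF smooth_on_continuous continuous_base_proj])
  qed
  then show ?thesis using assms(2) by (simp add: smooth_on_def)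
qed

section \<open>The monopole equation in components\<close>

lemma monopole_components:
  "dKP_hodge u p (ext_deriv0 V p + (1 / 2 * V p) *s dKP_one_form u p) = \<omega> \<longleftrightarrow>
   \<omega> = (\<chi> i j. if i = 1 \<and> j = 2 then - D\<^sub>x V p else if i = 2 \<and> j = 1 then D\<^sub>x V p
     else if i = 1 \<and> j = 3 then - 2 * D\<^sub>y V p else if i = 3 \<and> j = 1 then 2 * D\<^sub>y V p
     else if i = 2 \<and> j = 3 then 2 * u p * D\<^sub>x V p - D\<^sub>t V p + 2 * D\<^sub>x u p * V p
     else if i = 3 \<and> j = 2 then D\<^sub>t V p - 2 * u p * D\<^sub>x V p - 2 * D\<^sub>x u p * V p else 0)"
  by (auto simp: vec_eq_iff forall_3 dKP_hodge_def dKP_one_form_def ext_deriv0_def tensor_scale_def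
      wedge_def axis_def algebra_simps)
    (auto simp: eq_neg_iff_add_eq_0)

lemma monopole_onD:
  assumes "monopole_on W u V \<alpha>" "p \<in> W"
  shows "D\<^sub>x (\<lambda>q. \<alpha> q $ 2) p - D\<^sub>y (\<lambda>q. \<alpha> q $ 1) p = - D\<^sub>x V p"
    and "D\<^sub>x (\<lambda>q. \<alpha> q $ 3) p - D\<^sub>t (\<lambda>q. \<alpha> q $ 1) p = - 2 * D\<^sub>y V p"
    and "D\<^sub>y (\<lambda>q. \<alpha> q $ 3) p - D\<^sub>t (\<lambda>q. \<alpha> q $ 2) p
      = 2 * u p * D\<^sub>x V p - D\<^sub>t V p + 2 * D\<^sub>x u p * V p"
  using assms unfolding monopole_on_def monopole_components
  by (auto simp: vec_eq_iff forall_3 ext_deriv1_def)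

text \<open>
  The exterior derivative of the two-form on the left-hand side of the monopole equation is twice
  the linearised dKP operator applied to \<open>V\<close>, so it is closed and hence locally exact.
\<close>

lemma monopole_local_solution:
  fixes u V :: "'k::{real_normed_field, euclidean_space} ^ 3 \<Rightarrow> 'k"
  assumes U: "open U" and u: "smooth_on U u" and V: "smooth_on U V" and lin: "linearised_dKP_on U u V"
    and p: "p \<in> U"
  obtains W \<alpha> where "open W" "p \<in> W" "W \<subseteq> U" "smooth_one_form_on W \<alpha>" "monopole_on W u V \<alpha>"
proof -
  define A where "A = (\<lambda>q. - D\<^sub>x V q)"
  define B where "B = (\<lambda>q. - 2 * D\<^sub>y V q)"
  define C where "C = (\<lambda>q. 2 * u q * D\<^sub>x V q - D\<^sub>t V q + 2 * D\<^sub>x u q * V q)"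
  have sm: "smooth_on U A" "smooth_on U B" "smooth_on U C"
    unfolding A_def B_def C_def
    by (intro smooth_on_add smooth_on_diff smooth_on_minus smooth_on_mult smooth_on_const smooth_on_partial
        U u V)+
  have "D\<^sub>x C q - D\<^sub>y B q + D\<^sub>t A q = 0" if q: "q \<in> U" for q
  proof -
    note h = smooth_on_has_partial[OF u q] smooth_on_has_partial[OF V q]
      smooth_on_has_partial[OF smooth_on_partial[OF u] q] smooth_on_has_partial[OF smooth_on_partial[OF V] q]
    have "D\<^sub>t A q = - D\<^sub>t (D\<^sub>x V) q"
      unfolding A_def by (intro partial_deriv_eq has_partial_minus h)
    moreover have "D\<^sub>y B q = 0 * D\<^sub>y V q + (- 2) * D\<^sub>y (D\<^sub>y V) q"
      unfolding B_def by (intro partial_deriv_eq has_partial_mult has_partial_const h)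
    moreover have "D\<^sub>x C q = (0 * u q + 2 * D\<^sub>x u q) * D\<^sub>x V q + 2 * u q * D\<^sub>x (D\<^sub>x V) q
        - D\<^sub>x (D\<^sub>t V) q + ((0 * D\<^sub>x u q + 2 * D\<^sub>x (D\<^sub>x u) q) * V q + 2 * D\<^sub>x u q * D\<^sub>x V q)"
      unfolding C_def
      by (intro partial_deriv_eq has_partial_add has_partial_diff has_partial_mult has_partial_const h)
    moreover have "D\<^sub>x (D\<^sub>t V) q = D\<^sub>t (D\<^sub>x V) q"
      by (rule partial_deriv_commute[OF U V q])
    ultimately have "D\<^sub>x C q - D\<^sub>y B q + D\<^sub>t A q = 2 * (D\<^sub>y (D\<^sub>y V) q - D\<^sub>t (D\<^sub>x V) q + u q * D\<^sub>x (D\<^sub>x V) q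
            + 2 * D\<^sub>x u q * D\<^sub>x V q + D\<^sub>x (D\<^sub>x u) q * V q)"
      by (simp add: algebra_simps)
    also have "\<dots> = 2 * 0"
      using lin q unfolding linearised_dKP_on_def by (intro arg_cong[of _ _ "(*) 2"]) blast
    finally show ?thesis by simp
  qed
  from poincare_two_form_3[OF U p sm this] obtain W \<alpha> where W: "open W" "p \<in> W" "W \<subseteq> U" "smooth_one_form_on W \<alpha>"
    and d: "\<And>q. q \<in> W \<Longrightarrow> ext_deriv1 \<alpha> q $ 1 $ 2 = A q" "\<And>q. q \<in> W \<Longrightarrow> ext_deriv1 \<alpha> q $ 1 $ 3 = B q"
      "\<And>q. q \<in> W \<Longrightarrow> ext_deriv1 \<alpha> q $ 2 $ 3 = C q" by metis
  have skew: "ext_deriv1 \<alpha> q $ j $ i = - ext_deriv1 \<alpha> q $ i $ j" for q i j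
    by (simp add: ext_deriv1_def)
  have diag: "ext_deriv1 \<alpha> q $ i $ i = 0" for q i
    by (simp add: ext_deriv1_def)
  have "monopole_on W u V \<alpha>"
    unfolding monopole_on_def monopole_components
    by (auto simp: vec_eq_iff forall_3 d A_def B_def C_def diag skew[of _ 2 1] skew[of _ 3 1] skew[of _ 3 2])
  then show ?thesis using that W by blast
qed

section \<open>The null coframe and its connection\<close>

text \<open>
  With \<open>\<theta> = dz + \<alpha>\<close> the rows are
  \<open>m\<^sub>1 = (dy - \<theta> / V) / 2\<close>, \<open>m\<^sub>2 = V dy + \<theta>\<close>, \<open>m\<^sub>3 = 2 dt\<close> and \<open>m\<^sub>4 = V (dx + u dt)\<close>.
  They arise by factoring \<open>V dy\<^sup>2 - \<theta>\<^sup>2 / V\<close> and \<open>V (dx dt + u dt\<^sup>2)\<close>, so no square root of \<open>V\<close> is needed.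
  The factor \<open>V\<close> is distributed over the factors so that the self-dual half of the connection
  becomes as small as possible, see \<open>spin_matrix\<close>.
\<close>

definition null_coframe :: "'k::field \<Rightarrow> 'k \<Rightarrow> 'k ^ 3 \<Rightarrow> 'k ^ 4 ^ 4" where
  "null_coframe u V \<alpha> = vector
    [vector [- inverse V * \<alpha> $ 1 / 2, (1 - inverse V * \<alpha> $ 2) / 2, - inverse V * \<alpha> $ 3 / 2, - inverse V / 2],
     vector [\<alpha> $ 1, V + \<alpha> $ 2, \<alpha> $ 3, 1],
     vector [0, 0, 2, 0],
     vector [V, 0, V * u, 0]]"

definition null_frame :: "'k::field \<Rightarrow> 'k \<Rightarrow> 'k ^ 3 \<Rightarrow> 'k ^ 4 ^ 4" where
  "null_frame u V \<alpha> = vector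
    [vector [0, 0, - u / 2, inverse V],
     vector [1, inverse V / 2, 0, 0],
     vector [0, 0, 1 / 2, 0],
     vector [- \<alpha> $ 2 - V, (1 - inverse V * \<alpha> $ 2) / 2, (u * \<alpha> $ 1 - \<alpha> $ 3) / 2, - inverse V * \<alpha> $ 1]]"

text \<open>
  The general connection matrix with lowered entries \<open>w\<^sub>1\<^sub>2 = - w\<^sub>3\<^sub>4 = a\<close>, \<open>w\<^sub>1\<^sub>3 = b\<close>, \<open>w\<^sub>2\<^sub>3 = c\<close>, \<open>w\<^sub>2\<^sub>4 = d\<close> and
  \<open>w\<^sub>1\<^sub>4 = 0\<close>. Of the self-dual entries \<open>w\<^sub>1\<^sub>4\<close>, \<open>w\<^sub>1\<^sub>2 + w\<^sub>3\<^sub>4\<close> and \<open>w\<^sub>2\<^sub>3\<close> only the last is left; equivalently,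
  the null two-form \<open>m\<^sub>2 \<and> m\<^sub>3\<close> is parallel.
\<close>

definition spin_matrix :: "'k::field \<Rightarrow> 'k \<Rightarrow> 'k \<Rightarrow> 'k \<Rightarrow> 'k ^ 4 ^ 4" where
  "spin_matrix a b c d = vector
    [vector [- a, 0, c, d], vector [0, a, b, 0], vector [0, d, - a, 0], vector [b, c, 0, a]]"

lemma null_frame_coframe:
  "V \<noteq> 0 \<Longrightarrow> null_frame u V \<alpha> ** null_coframe u V \<alpha> = mat (1 :: 'k::field_char_0)"
  by (simp add: null_frame_def null_coframe_def vec_eq_iff forall_4 matrix_matrix_mult_def sum_4 mat_def
      field_simps)

lemma det_null_form: "det (null_form :: 'k::field ^ 4 ^ 4) = 1"
  by (simp add: det_4 null_form_def)

lemma det_null_coframe: "V \<noteq> 0 \<Longrightarrow> det (null_coframe u V \<alpha>) = 2 * (V :: 'k::field_char_0)"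
  by (simp add: null_coframe_def det_4 field_simps)

lemma spin_matrix_skew:
  "transpose (spin_matrix a b c d) ** null_form = - (null_form ** spin_matrix a b c d)"
  by (simp add: spin_matrix_def null_form_def vec_eq_iff forall_4 matrix_matrix_mult_def sum_4
      transpose_def)

lemma null_form_pullback:
  "(transpose \<Theta> ** null_form ** \<Theta>) $ i $ j
    = \<Theta> $ 1 $ i * \<Theta> $ 2 $ j + \<Theta> $ 2 $ i * \<Theta> $ 1 $ j - \<Theta> $ 3 $ i * \<Theta> $ 4 $ j - \<Theta> $ 4 $ i * (\<Theta> $ 3 $ j :: 'k::field)"
proof -
  have "(null_form ** \<Theta>) $ 1 = \<Theta> $ 2" "(null_form ** \<Theta>) $ 2 = \<Theta> $ 1"
    "(null_form ** \<Theta>) $ 3 = - \<Theta> $ 4" "(null_form ** \<Theta>) $ 4 = - \<Theta> $ 3"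
    by (simp_all add: vec_eq_iff null_form_def matrix_matrix_mult_def sum_4)
  moreover have "(transpose \<Theta> ** M) $ i $ j = (\<Sum>k\<in>UNIV. \<Theta> $ k $ i * M $ k $ j)" for M
    by (simp add: matrix_matrix_mult_def transpose_def)
  ultimately show ?thesis
    unfolding matrix_mul_assoc[symmetric] by (simp add: sum_4)
qed

lemma dKP_metric_matrix:
  "dKP_metric u q = vector [vector [0, 0, - 2], vector [0, 1, 0], vector [- 2, 0, - 4 * u q]]"
  by (simp add: dKP_metric_def vec_eq_iff forall_3 sym_prod_def tensor_scale_def axis_def)

lemma sym_prod_self: "sym_prod a a = (\<chi> i j. a $ i * (a $ j :: 'k::field_char_0))"
  by (simp add: sym_prod_def vec_eq_iff)

lemma dKP_monopole_metric_eq: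
  fixes u V :: "'k::real_normed_field ^ 3 \<Rightarrow> 'k"
  assumes V: "V (base_proj p) \<noteq> 0"
  shows "dKP_monopole_metric u V \<alpha> p
    = transpose (null_coframe (u (base_proj p)) (V (base_proj p)) (\<alpha> (base_proj p))) ** null_form
      ** null_coframe (u (base_proj p)) (V (base_proj p)) (\<alpha> (base_proj p))"
proof -
  define v where "v = V (base_proj p)"
  define r where "r = inverse v"
  define a where "a = \<alpha> (base_proj p)"
  have vr: "v * r = 1" using V by (simp add: v_def r_def)
  have bp: "matrix base_proj $ 1 $ j = axis 1 (1::'k) $ j" "matrix base_proj $ 2 $ j = axis 2 (1::'k) $ j"
    "matrix base_proj $ 3 $ j = axis 3 (1::'k) $ j" for j
    by (auto simp: matrix_def base_proj_def axis_def)
  have pb1: "pull_back1 b = vector [b $ 1, b $ 2, b $ 3, 0]" for b :: "'k ^ 3"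
    by (simp add: vec_eq_iff forall_4 pull_back1_def vector_matrix_mult_def sum_3 bp axis_def)
  have pb2: "pull_back2 A = vector [vector [A$1$1, A$1$2, A$1$3, 0], vector [A$2$1, A$2$2, A$2$3, 0],
      vector [A$3$1, A$3$2, A$3$3, 0], vector [0, 0, 0, 0]]" for A :: "'k ^ 3 ^ 3"
    by (simp add: vec_eq_iff forall_4 pull_back2_def matrix_matrix_mult_def sum_3
        transpose_def bp axis_def)
  have L: "dKP_monopole_metric u V \<alpha> p = v *\<^sub>t pull_back2 (dKP_metric u (base_proj p))
      - r *\<^sub>t sym_prod (vector [a $ 1, a $ 2, a $ 3, 1]) (vector [a $ 1, a $ 2, a $ 3, 1])"
  proof -
    have "dz + pull_back1 a = vector [a $ 1, a $ 2, a $ 3, 1]"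
      by (simp add: pb1 vec_eq_iff forall_4 axis_def)
    then show ?thesis by (simp add: dKP_monopole_metric_def Let_def v_def r_def a_def)
  qed
  show ?thesis
    unfolding L v_def[symmetric] a_def[symmetric] null_coframe_def r_def[symmetric]
    unfolding vec_eq_iff forall_4 null_form_pullback pb2 dKP_metric_matrix sym_prod_self
    by (simp add: tensor_scale_def) (use vr in algebra)
qed

text \<open>
  The components of the one-form \<open>c\<^sub>1 dx + c\<^sub>2 dy + c\<^sub>3 dt + z \<theta>\<close>.
\<close>

definition lift_form :: "'k::field ^ 3 \<Rightarrow> 'k ^ 3 \<Rightarrow> 'k \<Rightarrow> 4 \<Rightarrow> 'k" where
  "lift_form a c z i = (vector [c $ 1 + z * a $ 1, c $ 2 + z * a $ 2, c $ 3 + z * a $ 3, z] :: 'k ^ 4) $ i"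

lemma lift_form_simps [simp]:
  "lift_form a c z 1 = c $ 1 + z * a $ 1" "lift_form a c z 2 = c $ 2 + z * a $ 2"
  "lift_form a c z 3 = c $ 3 + z * a $ 3" "lift_form a c z 4 = z"
  by (simp_all add: lift_form_def)

text \<open>
  The derivative of \<open>null_coframe\<close> along a direction in which \<open>u\<close>, \<open>V\<close>, \<open>\<alpha>\<close> have derivatives \<open>u'\<close>, \<open>V'\<close>, \<open>\<alpha>'\<close>.
\<close>

definition null_coframe_deriv :: "'k::field \<Rightarrow> 'k \<Rightarrow> 'k ^ 3 \<Rightarrow> 'k \<Rightarrow> 'k \<Rightarrow> 'k ^ 3 \<Rightarrow> 'k ^ 4 ^ 4" where
  "null_coframe_deriv u V \<alpha> u' V' \<alpha>' = (let r = inverse V; r' = - (V' * (r * r)) in vector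
    [vector [- (r' * \<alpha> $ 1 + r * \<alpha>' $ 1) / 2, - (r' * \<alpha> $ 2 + r * \<alpha>' $ 2) / 2, - (r' * \<alpha> $ 3 + r * \<alpha>' $ 3) / 2, - r' / 2],
     vector [\<alpha>' $ 1, V' + \<alpha>' $ 2, \<alpha>' $ 3, 0],
     vector [0, 0, 0, 0],
     vector [V', 0, V' * u + V * u', 0]])"

text \<open>
  Cartan's first structure equation at a point, with all derivatives as independent numbers. The
  connection forms were obtained by solving this linear system for them. Only the exterior
  derivative of \<open>\<alpha>\<close> matters, and the monopole equation expresses it through \<open>u\<close> and \<open>V\<close>.
\<close>

lemma torsion_identity:
  fixes V u ux uy Vx Vy Vt :: "'k::field_char_0" and a alx aly alt :: "'k ^ 3" and du dV :: "4 \<Rightarrow> 'k"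
  assumes V: "V \<noteq> 0"
    and F12: "alx $ 2 - aly $ 1 = - Vx" and F13: "alx $ 3 - alt $ 1 = - 2 * Vy"
    and F23: "aly $ 3 - alt $ 2 = 2 * u * Vx - Vt + 2 * ux * V"
    and du: "du 1 = ux" "du 2 = uy" "du 4 = 0" and dV: "dV 1 = Vx" "dV 2 = Vy" "dV 3 = Vt" "dV 4 = 0"
    and da: "da 1 = alx" "da 2 = aly" "da 3 = alt" "da 4 = 0"
  defines "r \<equiv> inverse V" and "P \<equiv> Vt - u * Vx - V * ux"
  defines "A \<equiv> lift_form a (vector [0, - Vy * r / 2, - P * r]) (- Vy * r ^ 2 / 2)"
    and "B \<equiv> lift_form a (vector [Vy, P / 2, V * uy + Vy * u]) (- P * r / 2)"
    and "C \<equiv> lift_form a (vector [0, ux / 4, uy / 2]) (ux * r / 4)"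
    and "D \<equiv> lift_form a (vector [0, Vx * r ^ 2 / 2, Vy * r ^ 2]) (Vx * r ^ 3 / 2)"
  defines "T i \<equiv> null_coframe_deriv u V a (du i) (dV i) (da i)
      + spin_matrix (A i) (B i) (C i) (D i) ** null_coframe u V a"
  shows "T i $ k $ j = T j $ k $ i"
proof -
  have rel: "alx $ 2 = aly $ 1 - Vx" "alx $ 3 = alt $ 1 - 2 * Vy"
    "aly $ 3 = alt $ 2 + 2 * u * Vx - Vt + 2 * ux * V"
    using F12 F13 F23 by (simp_all add: diff_eq_eq)
  note [simp] = T_def null_coframe_deriv_def null_coframe_def Let_def spin_matrix_def matrix_matrix_mult_def
    sum_4 r_def du dV da A_def B_def C_def D_def P_def rel
  have "T 1 $ 1 $ 2 = T 2 $ 1 $ 1 \<and> T 1 $ 2 $ 2 = T 2 $ 2 $ 1 \<and> T 1 $ 3 $ 2 = T 2 $ 3 $ 1 \<and> T 1 $ 4 $ 2 = T 2 $ 4 $ 1"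
    by (simp add: V field_simps power2_eq_square power3_eq_cube)
  moreover have "T 1 $ 1 $ 3 = T 3 $ 1 $ 1 \<and> T 1 $ 2 $ 3 = T 3 $ 2 $ 1 \<and> T 1 $ 3 $ 3 = T 3 $ 3 $ 1 \<and> T 1 $ 4 $ 3 = T 3 $ 4 $ 1"
    by (simp add: V field_simps power2_eq_square power3_eq_cube)
  moreover have "T 1 $ 1 $ 4 = T 4 $ 1 $ 1 \<and> T 1 $ 2 $ 4 = T 4 $ 2 $ 1 \<and> T 1 $ 3 $ 4 = T 4 $ 3 $ 1 \<and> T 1 $ 4 $ 4 = T 4 $ 4 $ 1"
    by (simp add: V field_simps power2_eq_square power3_eq_cube)
  moreover have "T 2 $ 1 $ 3 = T 3 $ 1 $ 2 \<and> T 2 $ 2 $ 3 = T 3 $ 2 $ 2 \<and> T 2 $ 3 $ 3 = T 3 $ 3 $ 2 \<and> T 2 $ 4 $ 3 = T 3 $ 4 $ 2"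
    by (simp add: V field_simps power2_eq_square power3_eq_cube)
  moreover have "T 2 $ 1 $ 4 = T 4 $ 1 $ 2 \<and> T 2 $ 2 $ 4 = T 4 $ 2 $ 2 \<and> T 2 $ 3 $ 4 = T 4 $ 3 $ 2 \<and> T 2 $ 4 $ 4 = T 4 $ 4 $ 2"
    by (simp add: V field_simps power2_eq_square power3_eq_cube)
  moreover have "T 3 $ 1 $ 4 = T 4 $ 1 $ 3 \<and> T 3 $ 2 $ 4 = T 4 $ 2 $ 3 \<and> T 3 $ 3 $ 4 = T 4 $ 3 $ 3 \<and> T 3 $ 4 $ 4 = T 4 $ 4 $ 3"
    by (simp add: V field_simps power2_eq_square power3_eq_cube)
  ultimately show ?thesis
    using exhaust_4[of i] exhaust_4[of j] exhaust_4[of k] by (elim disjE) (simp_all only:)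
qed

text \<open>
  The self-dual part of the quadratic term of the curvature vanishes: the self-dual half of the
  connection has values in a one-dimensional, hence abelian, Lie algebra.
\<close>

lemma spin_matrix_commutator:
  fixes \<omega> \<omega>' :: "'k::field ^ 4 ^ 4"
  assumes X: "\<omega> = spin_matrix a b c d" and Y: "\<omega>' = spin_matrix a' b' c' d'"
  shows "(\<omega> ** \<omega>' - \<omega>' ** \<omega>) $ 2 $ 4 = 0" "(\<omega> ** \<omega>' - \<omega>' ** \<omega>) $ 2 $ 2 = (\<omega> ** \<omega>' - \<omega>' ** \<omega>) $ 4 $ 4"
    "(\<omega> ** \<omega>' - \<omega>' ** \<omega>) $ 1 $ 3 = 0"
  by (simp_all add: X Y spin_matrix_def matrix_matrix_mult_def sum_4)

lemma null_form_lower: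
  fixes M :: "'k::field ^ 4 ^ 4"
  shows "(null_form ** M) $ 1 $ 4 = M $ 2 $ 4" "(null_form ** M) $ 1 $ 2 = M $ 2 $ 2"
    "(null_form ** M) $ 3 $ 4 = - M $ 4 $ 4" "(null_form ** M) $ 2 $ 3 = M $ 1 $ 3"
  by (simp_all add: null_form_def matrix_matrix_mult_def sum_4)

lemma killing_del_z:
  fixes u V :: "'k::real_normed_field ^ 3 \<Rightarrow> 'k"
  assumes "open W"
  shows "killing_field_on (base_proj -` W) del_z (dKP_monopole_metric u V \<alpha>)"
proof -
  have "partial_deriv 4 (\<lambda>q. dKP_monopole_metric u V \<alpha> q $ i $ j) p = 0" for i j p
    by (rule partial_deriv_eq)
      (simp add: has_partial_def base_proj_line dKP_monopole_metric_def Let_def)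
  moreover have "partial_deriv i (\<lambda>q. del_z q $ k) p = (0 :: 'k)" for i k p
    unfolding del_z_def by (rule partial_deriv_eq) (rule has_partial_const)
  ultimately have "lie_deriv_metric del_z (dKP_monopole_metric u V \<alpha>) p = 0" for p
    by (simp add: lie_deriv_metric_def vec_eq_iff sum_4) (simp add: del_z_def axis_def)
  moreover have "smooth_on (base_proj -` W) (\<lambda>p. del_z p $ i :: 'k)" for i
    unfolding del_z_def by (intro smooth_on_const open_base_proj_vimage assms)
  ultimately show ?thesis by (simp add: killing_field_on_def)
qed

locale dKP_monopole =
  fixes W :: "('k::{real_normed_field, euclidean_space} ^ 3) set"
    and u V :: "'k ^ 3 \<Rightarrow> 'k" and \<alpha> :: "'k ^ 3 \<Rightarrow> 'k ^ 3"
  assumes open_W: "open W" and u: "smooth_on W u" and dKP: "dKP_on W u"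
    and V: "smooth_on W V" and V0: "\<forall>p\<in>W. V p \<noteq> 0"
    and \<alpha>: "smooth_one_form_on W \<alpha>" and monopole: "monopole_on W u V \<alpha>"
begin

definition V_inv where "V_inv q = inverse (V q)"
definition P where "P q = D\<^sub>t V q - u q * D\<^sub>x V q - V q * D\<^sub>x u q"

text \<open>
  Written in the basis \<open>dx, dy, dt, \<theta>\<close> the coefficients of the connection forms do not contain \<open>\<alpha>\<close>.
  Only \<open>form_c\<close> contributes to the self-dual curvature; the others are there to make the torsion vanish.
\<close>

definition form_a where "form_a i q = lift_form (\<alpha> q)
  (vector [0, - D\<^sub>y V q * V_inv q / 2, - P q * V_inv q]) (- D\<^sub>y V q * V_inv q ^ 2 / 2) i"
definition form_b where "form_b i q = lift_form (\<alpha> q)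
  (vector [D\<^sub>y V q, P q / 2, V q * D\<^sub>y u q + D\<^sub>y V q * u q]) (- P q * V_inv q / 2) i"
definition form_c where "form_c i q = lift_form (\<alpha> q)
  (vector [0, D\<^sub>x u q / 4, D\<^sub>y u q / 2]) (D\<^sub>x u q * V_inv q / 4) i"
definition form_d where "form_d i q = lift_form (\<alpha> q)
  (vector [0, D\<^sub>x V q * V_inv q ^ 2 / 2, D\<^sub>y V q * V_inv q ^ 2]) (D\<^sub>x V q * V_inv q ^ 3 / 2) i"

definition coframe where "coframe p = null_coframe (u (base_proj p)) (V (base_proj p)) (\<alpha> (base_proj p))"
definition frame where "frame p = null_frame (u (base_proj p)) (V (base_proj p)) (\<alpha> (base_proj p))"
definition spin where "spin i p = spin_matrix (form_a i (base_proj p)) (form_b i (base_proj p))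
  (form_c i (base_proj p)) (form_d i (base_proj p))"

abbreviation S where "S \<equiv> base_proj -` W"

lemma open_S: "open S"
  by (rule open_base_proj_vimage[OF open_W])

lemma smooth_V_inv: "smooth_on W V_inv"
  unfolding V_inv_def[abs_def] by (rule smooth_on_inverse[OF open_W V V0])

lemma smooth_\<alpha>: "smooth_on W (\<lambda>q. \<alpha> q $ i)"
  using \<alpha> by (simp add: smooth_one_form_on_def)

lemma smooth_P: "smooth_on W P"
  unfolding P_def[abs_def]
  by (intro smooth_on_diff smooth_on_mult smooth_on_partial open_W u V)

lemmas smooth_intros = smooth_on_add smooth_on_diff smooth_on_mult smooth_on_minus smooth_on_const
  smooth_on_partial open_W u V smooth_V_inv smooth_\<alpha> smooth_P

lemma smooth_power: "smooth_on W f \<Longrightarrow> smooth_on W (\<lambda>q. f q ^ n)"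
  by (induction n) (auto intro: smooth_intros)

lemma smooth_divide_numeral: "smooth_on W f \<Longrightarrow> smooth_on W (\<lambda>q. f q / numeral n)"
  by (intro smooth_on_divide smooth_intros) auto

lemma smooth_lift_form:
  assumes "smooth_on W c1" "smooth_on W c2" "smooth_on W c3" "smooth_on W z"
  shows "smooth_on W (\<lambda>q. lift_form (\<alpha> q) (vector [c1 q, c2 q, c3 q]) (z q) i)"
  using exhaust_4[of i] assms by (elim disjE) (auto intro!: smooth_intros)

lemma smooth_forms:
  "smooth_on W (form_a i)" "smooth_on W (form_b i)" "smooth_on W (form_c i)" "smooth_on W (form_d i)"
  unfolding form_a_def[abs_def] form_b_def[abs_def] form_c_def[abs_def] form_d_def[abs_def]
  by (intro smooth_lift_form smooth_intros smooth_power smooth_divide_numeral)+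

lemma smooth_spin: "smooth_mat S (spin i)"
  unfolding smooth_mat_def
proof (intro allI)
  fix a b :: 4
  have "smooth_on W (\<lambda>q. spin_matrix (form_a i q) (form_b i q) (form_c i q) (form_d i q) $ a $ b)"
    unfolding spin_matrix_def using exhaust_4[of a] exhaust_4[of b] smooth_forms[of i]
    by (elim disjE) (auto intro!: smooth_intros)
  from smooth_on_base_proj[OF open_W this] show "smooth_on S (\<lambda>p. spin i p $ a $ b)"
    by (simp add: spin_def)
qed

lemma smooth_coframe: "smooth_mat S coframe"
  unfolding smooth_mat_def
proof (intro allI)
  fix a b :: 4
  have "smooth_on W (\<lambda>q. null_coframe (u q) (V q) (\<alpha> q) $ a $ b)"
    unfolding null_coframe_def V_inv_def[symmetric] using exhaust_4[of a] exhaust_4[of b]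
    by (elim disjE) (auto intro!: smooth_intros smooth_divide_numeral)
  from smooth_on_base_proj[OF open_W this] show "smooth_on S (\<lambda>p. coframe p $ a $ b)"
    by (simp add: coframe_def)
qed

lemma smooth_frame: "smooth_mat S frame"
  unfolding smooth_mat_def
proof (intro allI)
  fix a b :: 4
  have "smooth_on W (\<lambda>q. null_frame (u q) (V q) (\<alpha> q) $ a $ b)"
    unfolding null_frame_def V_inv_def[symmetric] using exhaust_4[of a] exhaust_4[of b]
    by (elim disjE) (auto intro!: smooth_intros smooth_divide_numeral)
  from smooth_on_base_proj[OF open_W this] show "smooth_on S (\<lambda>p. frame p $ a $ b)"
    by (simp add: frame_def)
qed

lemma partial_coframe:
  assumes p: "p \<in> S"
  shows "partial_mat i coframe p = null_coframe_deriv (u (base_proj p)) (V (base_proj p)) (\<alpha> (base_proj p))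
     (lifted_partial i u (base_proj p)) (lifted_partial i V (base_proj p))
     (\<chi> j. lifted_partial i (\<lambda>q. \<alpha> q $ j) (base_proj p))" (is "_ = ?D")
proof (rule partial_mat_eq)
  have q: "base_proj p \<in> W" using p by simp
  have nz: "V (base_proj p) \<noteq> 0" using V0 q by blast
  have hu: "has_partial i (\<lambda>p. u (base_proj p)) (lifted_partial i u (base_proj p)) p"
    by (rule has_partial_base_proj[OF u q])
  have hV: "has_partial i (\<lambda>p. V (base_proj p)) (lifted_partial i V (base_proj p)) p"
    by (rule has_partial_base_proj[OF V q])
  have ha: "has_partial i (\<lambda>p. \<alpha> (base_proj p) $ j) (lifted_partial i (\<lambda>q. \<alpha> q $ j) (base_proj p)) p" for j
    by (rule has_partial_base_proj[OF smooth_\<alpha> q])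
  note hr = has_partial_inverse[OF hV nz]
  have half: "has_partial i (\<lambda>p. f p / 2) (f' / 2) p" if "has_partial i f f' p" for f f'
    using that unfolding has_partial_def by (rule DERIV_cdivide)
  have "\<forall>a b. has_partial i (\<lambda>q. coframe q $ a $ b) (?D $ a $ b) p"
    unfolding forall_4 coframe_def null_coframe_def null_coframe_deriv_def Let_def
    using half[OF has_partial_mult[OF has_partial_minus[OF hr] ha[of 1]]]
      half[OF has_partial_diff[OF has_partial_const[of i 1 p] has_partial_mult[OF hr ha[of 2]]]]
      half[OF has_partial_mult[OF has_partial_minus[OF hr] ha[of 3]]]
      half[OF has_partial_minus[OF hr]] ha has_partial_add[OF hV ha[of 2]]
      hV has_partial_mult[OF hV hu] has_partial_const[of i 0 p] has_partial_const[of i 1 p] has_partial_const[of i 2 p]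
    by (simp add: algebra_simps)
  then show "has_partial_mat i coframe ?D p" by (simp add: has_partial_mat_def)
qed

lemma torsion:
  assumes p: "p \<in> S"
  shows "(partial_mat i coframe p + spin i p ** coframe p) $ a $ j = (partial_mat j coframe p + spin j p ** coframe p) $ a $ i"
proof -
  have q: "base_proj p \<in> W" using p by simp
  note F = monopole_onD[OF monopole q]
  define da where "da i = (\<chi> j. lifted_partial i (\<lambda>q. \<alpha> q $ j) (base_proj p))" for i
  have "V (base_proj p) \<noteq> 0" using V0 q by blast
  from torsion_identity[OF this, where du = "\<lambda>i. lifted_partial i u (base_proj p)" and
      dV = "\<lambda>i. lifted_partial i V (base_proj p)" and da = da and k = a and i = i and j = j and a = "\<alpha> (base_proj p)"
      and u = "u (base_proj p)" and ux = "D\<^sub>x u (base_proj p)" and uy = "D\<^sub>y u (base_proj p)"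
      and Vx = "D\<^sub>x V (base_proj p)" and Vy = "D\<^sub>y V (base_proj p)" and Vt = "D\<^sub>t V (base_proj p)"
      and alx = "da 1" and aly = "da 2" and alt = "da 3"]
  show ?thesis
    using F by (simp add: da_def partial_coframe[OF p] spin_def coframe_def form_a_def form_b_def form_c_def
        form_d_def V_inv_def P_def vec_eq_iff)
qed

sublocale moving_frame S coframe frame null_form spin "dKP_monopole_metric u V \<alpha>"
proof
  fix p assume p: "p \<in> S"
  then have V: "V (base_proj p) \<noteq> 0" using V0 by blast
  show "frame p ** coframe p = mat 1"
    unfolding frame_def coframe_def by (rule null_frame_coframe[OF V])
  show "dKP_monopole_metric u V \<alpha> p = transpose (coframe p) ** null_form ** coframe p"
    unfolding coframe_def by (rule dKP_monopole_metric_eq) (rule V)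
  show "transpose (spin i p) ** null_form = - (null_form ** spin i p)" for i
    unfolding spin_def by (rule spin_matrix_skew)
qed (fact open_S smooth_coframe smooth_frame smooth_spin null_form_sym null_form_involution torsion)+

lemma curv_entries:
  assumes p: "p \<in> S"
  shows "(null_form ** curv i j p) $ 1 $ 4 = 0"
    and "(null_form ** curv i j p) $ 1 $ 2 + (null_form ** curv i j p) $ 3 $ 4 = 0"
    and "(null_form ** curv i j p) $ 2 $ 3
      = lifted_partial i (form_c j) (base_proj p) - lifted_partial j (form_c i) (base_proj p)"
proof -
  have q: "base_proj p \<in> W" using p by simp
  have d24: "partial_mat i (spin j) p $ 2 $ 4 = 0" for i j
    by (simp add: partial_mat_def spin_def spin_matrix_def partial_deriv_eq[OF has_partial_const])
  have d22: "partial_mat i (spin j) p $ 2 $ 2 = partial_mat i (spin j) p $ 4 $ 4" for i j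
    by (simp add: partial_mat_def spin_def spin_matrix_def)
  have d13: "partial_mat i (spin j) p $ 1 $ 3 = lifted_partial i (form_c j) (base_proj p)" for i j
    using partial_base_proj[OF smooth_forms(3) q, of i j]
    by (simp add: partial_mat_def spin_def spin_matrix_def)
  note e = spin_matrix_commutator[OF spin_def[of i p] spin_def[of j p]]
  show "(null_form ** curv i j p) $ 1 $ 4 = 0"
    "(null_form ** curv i j p) $ 1 $ 2 + (null_form ** curv i j p) $ 3 $ 4 = 0"
    "(null_form ** curv i j p) $ 2 $ 3
      = lifted_partial i (form_c j) (base_proj p) - lifted_partial j (form_c i) (base_proj p)"
    unfolding null_form_lower curv_def using e d24 d22 d13 by simp_all
qed

text \<open>
  The remaining self-dual component of the curvature is \<open>d c (e\<^sub>2, e\<^sub>3)\<close> for the connection form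
  \<open>c = w\<^sub>2\<^sub>3\<close>. It contains second derivatives of \<open>u\<close> only in the combination of the dKP equation, and
  its terms of first order cancel by the monopole equation.
\<close>

lemma curv_2323:
  assumes p: "p \<in> S"
  shows "contract (e p 2) (\<lambda>i. contract (e p 3) (\<lambda>j. (null_form ** curv i j p) $ 2 $ 3)) = 0"
proof -
  define q where "q = base_proj p"
  have q: "q \<in> W" using p by (simp add: q_def)
  have nz: "V q \<noteq> 0" using V0 q by blast
  have quarter: "has_partial i (\<lambda>p. f p / numeral n) (f' / numeral n) q" if "has_partial i f f' q" for i n f f'
    using that unfolding has_partial_def by (rule DERIV_cdivide)
  have V_inv: "has_partial i V_inv (- (partial_deriv i V q * (V_inv q * V_inv q))) q" for i
    unfolding V_inv_def[abs_def] by (rule has_partial_inverse[OF smooth_on_has_partial[OF V q] nz])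
  define z where "z = (\<lambda>q. D\<^sub>x u q * V_inv q / 4)"
  have z: "has_partial i z ((partial_deriv i (D\<^sub>x u) q * V_inv q - D\<^sub>x u q * (partial_deriv i V q * (V_inv q * V_inv q))) / 4) q" for i
    using quarter[OF has_partial_mult[OF smooth_on_has_partial[OF smooth_on_partial[OF u] q] V_inv]]
    unfolding z_def by fastforce
  note a = smooth_on_has_partial[OF smooth_\<alpha> q]
  note du = smooth_on_has_partial[OF smooth_on_partial[OF u] q]
  have c: "form_c 1 = (\<lambda>q. z q * \<alpha> q $ 1)" "form_c 2 = (\<lambda>q. D\<^sub>x u q / 4 + z q * \<alpha> q $ 2)"
    "form_c 3 = (\<lambda>q. D\<^sub>y u q / 2 + z q * \<alpha> q $ 3)" "form_c 4 = z"
    by (auto simp: form_c_def z_def)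
  note dc1 = partial_deriv_eq[OF has_partial_mult[OF z a]]
  note dc2 = partial_deriv_eq[OF has_partial_add[OF quarter[OF du] has_partial_mult[OF z a]]]
  have yx: "D\<^sub>y (D\<^sub>x u) q = D\<^sub>x (D\<^sub>y u) q" and tx: "D\<^sub>t (D\<^sub>x u) q = D\<^sub>x (D\<^sub>t u) q"
    by (rule partial_deriv_commute[OF open_W u q])+
  have "D\<^sub>x (\<lambda>q. D\<^sub>t u q - u q * D\<^sub>x u q) q = D\<^sub>x (D\<^sub>t u) q - (D\<^sub>x u q * D\<^sub>x u q + u q * D\<^sub>x (D\<^sub>x u) q)"
    by (intro partial_deriv_eq has_partial_diff has_partial_mult du smooth_on_has_partial[OF u q])
  then have yy: "D\<^sub>y (D\<^sub>y u) q = D\<^sub>x (D\<^sub>t u) q - (D\<^sub>x u q * D\<^sub>x u q + u q * D\<^sub>x (D\<^sub>x u) q)"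
    using dKP q by (simp add: dKP_on_def)
  note F = monopole_onD[OF monopole q]
  have rel: "D\<^sub>x (\<lambda>q. \<alpha> q $ 2) q = D\<^sub>y (\<lambda>q. \<alpha> q $ 1) q - D\<^sub>x V q"
    "D\<^sub>x (\<lambda>q. \<alpha> q $ 3) q = D\<^sub>t (\<lambda>q. \<alpha> q $ 1) q - 2 * D\<^sub>y V q"
    "D\<^sub>y (\<lambda>q. \<alpha> q $ 3) q = D\<^sub>t (\<lambda>q. \<alpha> q $ 2) q + 2 * u q * D\<^sub>x V q - D\<^sub>t V q + 2 * D\<^sub>x u q * V q"
    using F by (simp_all add: diff_eq_eq)
  have zq: "z q = D\<^sub>x u q * V_inv q / 4" by (simp add: z_def)
  have rq: "V_inv q = inverse (V q)" by (simp add: V_inv_def)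
  have e2: "e p 2 = vector [0, V_inv q / 2, 0, (1 - V_inv q * \<alpha> q $ 2) / 2]"
    and e3: "e p 3 = vector [- u q / 2, 0, 1 / 2, (u q * \<alpha> q $ 1 - \<alpha> q $ 3) / 2]"
    by (simp_all add: column_def frame_def null_frame_def vec_eq_iff forall_4 q_def V_inv_def)
  show ?thesis
    unfolding curv_entries(3)[OF p] q_def[symmetric] contract_def sum_4 e2 e3
    by (simp add: c dc1 dc2 partial_deriv_eq[OF z] zq yx tx yy rel rq)
      (simp add: nz field_simps)
qed

text \<open>
  The null frame yields an orthonormal one over any field of characteristic zero, by combining the
  two vectors of each hyperbolic plane.
\<close>

lemma split_signature: "metric4_on S (dKP_monopole_metric u V \<alpha>)"
  unfolding metric4_on_def
proof (intro conjI ballI allI)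
  fix i j
  have "smooth_mat S (\<lambda>p. transpose (coframe p) ** null_form ** coframe p)"
    by (intro smooth_mat_mult smooth_mat_transpose smooth_mat_const open_S smooth_coframe)
  then have "smooth_on S (\<lambda>p. (transpose (coframe p) ** null_form ** coframe p) $ i $ j)"
    by (simp add: smooth_mat_def)
  then show "smooth_on S (\<lambda>p. dKP_monopole_metric u V \<alpha> p $ i $ j)"
    by (subst smooth_on_cong[OF open_S]) (simp_all add: metric_eq)
next
  fix p assume p: "p \<in> S"
  show "transpose (dKP_monopole_metric u V \<alpha> p) = dKP_monopole_metric u V \<alpha> p"
    by (rule metric_sym[OF p])
  define C :: "'k ^ 4 ^ 4" where "C = vector [vector [1, 0, 1, 0], vector [1 / 2, 0, - 1 / 2, 0],
    vector [0, 1, 0, 1], vector [0, - 1 / 2, 0, 1 / 2]]"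
  have "transpose C ** null_form ** C = split_form"
    unfolding vec_eq_iff forall_4 null_form_pullback by (simp add: C_def split_form_def)
  moreover have "transpose (frame p ** C) ** dKP_monopole_metric u V \<alpha> p ** (frame p ** C)
      = transpose C ** null_form ** C"
    using frame_metric[OF p] by (simp add: matrix_transpose_mul matrix_mul_assoc[symmetric])
      (simp add: matrix_mul_assoc)
  ultimately show "\<exists>B. transpose B ** dKP_monopole_metric u V \<alpha> p ** B = split_form"
    by metis
qed

lemma anti_self_dual: "anti_self_dual_on S (dKP_monopole_metric u V \<alpha>)"
  unfolding anti_self_dual_on_def
proof (intro exI conjI ballI allI)
  \<comment> \<open>The sign selects the orientation for which the parallel form \<open>m\<^sub>2 \<and> m\<^sub>3\<close> is self-dual.\<close>
  define w where "w p = - (2 * V (base_proj p))" for p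
  have det: "det (coframe p) = 2 * V (base_proj p)" if "p \<in> S" for p
    using that V0 unfolding coframe_def by (intro det_null_coframe) auto
  have "det (dKP_monopole_metric u V \<alpha> p) = (w p)\<^sup>2" if "p \<in> S" for p
    using that by (simp add: metric_eq det_mul det det_null_form w_def power2_eq_square)
  moreover have "smooth_on S w"
    unfolding w_def[abs_def]
    by (rule smooth_on_base_proj[OF open_W]) (intro smooth_intros)
  ultimately show "volume_form_on S (dKP_monopole_metric u V \<alpha>) w"
    by (simp add: volume_form_on_def)
  fix p i j k l assume p: "p \<in> S"
  show "weyl_self_dual_part (dKP_monopole_metric u V \<alpha>) w i j k l p = 0"
    by (rule weyl_self_dual_part_vanishes[OF p refl _ curv_entries(1,2)[OF p] curv_2323[OF p]])
      (simp add: w_def det[OF p])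
qed

end

theorem mainTheorem5:
  fixes U :: "('k::{real_normed_field, euclidean_space} ^ 3) set"
    and u V :: "'k ^ 3 \<Rightarrow> 'k"
  assumes "open U"
    and "smooth_on U u"
    and "dKP_on U u"
    and "smooth_on U V"
    and "\<forall>p\<in>U. V p \<noteq> 0"
    and "linearised_dKP_on U u V"
  shows "(\<forall>p\<in>U. \<exists>W \<alpha>. open W \<and> p \<in> W \<and> W \<subseteq> U
             \<and> smooth_one_form_on W \<alpha> \<and> monopole_on W u V \<alpha>)
    \<and> (\<forall>W \<alpha>. open W \<longrightarrow> W \<subseteq> U \<longrightarrow> smooth_one_form_on W \<alpha> \<longrightarrow> monopole_on W u V \<alpha> \<longrightarrow>
          metric4_on (base_proj -` W) (dKP_monopole_metric u V \<alpha>)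
        \<and> anti_self_dual_on (base_proj -` W) (dKP_monopole_metric u V \<alpha>)
        \<and> killing_field_on (base_proj -` W) del_z (dKP_monopole_metric u V \<alpha>))"
proof (intro conjI ballI allI impI)
  fix p assume "p \<in> U"
  then show "\<exists>W \<alpha>. open W \<and> p \<in> W \<and> W \<subseteq> U \<and> smooth_one_form_on W \<alpha> \<and> monopole_on W u V \<alpha>"
    using monopole_local_solution[OF assms(1,2,4,6)] by metis
next
  fix W and \<alpha> :: "'k ^ 3 \<Rightarrow> 'k ^ 3"
  assume W: "open W" "W \<subseteq> U" "smooth_one_form_on W \<alpha>" "monopole_on W u V \<alpha>"
  interpret dKP_monopole W u V \<alpha>
    using W assms smooth_on_subset[OF assms(2) W(2)] smooth_on_subset[OF assms(4) W(2)]
    by unfold_locales (auto simp: dKP_on_def)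
  show "metric4_on (base_proj -` W) (dKP_monopole_metric u V \<alpha>)"
    by (rule split_signature)
  show "anti_self_dual_on (base_proj -` W) (dKP_monopole_metric u V \<alpha>)"
    by (rule anti_self_dual)
  show "killing_field_on (base_proj -` W) del_z (dKP_monopole_metric u V \<alpha>)"
    by (rule killing_del_z[OF W(1)])
qed

end
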